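(* For any finite groupoid $\mathcal G$ there is a 0-cell $\frac XG$ of $\mathbb S$ admitting an equivalence of categories $\mathbb E(\frac XG)\simeq\mathcal G$. In particular, the 2-functor $\mathbb E\colon\mathbb S\to\mathrm{finGpd}$ is a biequivalence.
   Context: $\mathrm{finGpd}$ is the 2-category of finite groupoids, functors and natural transformations. A biequivalence is a 2-functor that induces equivalences on all hom-categories and is surjective on 0-cells up to equivalence. All groups are finite. The 2-category $\mathbb S$. 0-cells: pairs $\frac XG$ with $G$ a finite group and $X$ a finite left $G$-set. A 1-cell $\frac\alpha\theta\colon\frac XG\to\frac YH$ is a map $\alpha\colon X\to Y$ with maps $\theta_x\colon G\to H$ ($x\in X$) such that $\alpha(gx)=\theta_x(g)\alpha(x)$ and $\theta_x(gg')=\theta_{g'x}(g)\theta_x(g')$; composition is $(\frac\beta\tau)\circ(\frac\alpha\theta)=\frac{\beta\circ\alpha}{\tau\circ\theta}$ with $(\tau\circ\theta)_x=\tau_{\alpha(x)}\circ\theta_x$; the identity of $\frac XG$ is $\mathrm{id}_X$ with all $\theta_x=\mathrm{id}_G$. A 2-cell $\varepsilon\colon\frac\alpha\theta\Rightarrow\frac{\alpha'}{\theta'}$ is a family $\varepsilon_x\in H$ with $\alpha'(x)=\varepsilon_x\alpha(x)$ and $\varepsilon_{gx}\theta_x(g)\varepsilon_x^{-1}=\theta'_x(g)$; vertical composition is $(\varepsilon'\cdot\varepsilon)_x=\varepsilon'_x\varepsilon_x$, whiskering is $(\frac\beta\tau\circ\varepsilon)_x=\tau_{\alpha(x)}(\varepsilon_x)$,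 $(\rho\circ\frac\alpha\theta)_x=\rho_{\alpha(x)}$. The strict 2-functor $\mathbb E\colon\mathbb S\to\mathrm{finGpd}$: $\mathbb E(\frac XG)$ has object set $X$ and morphisms $x\to x'$ the $g\in G$ with $gx=x'$ (composition is multiplication in $G$); $\mathbb E(\frac\alpha\theta)$ is $\alpha$ on objects and sends $g\colon x\to gx$ to $\theta_x(g)$; $\mathbb E(\varepsilon)$ is the natural transformation with components $\varepsilon_x$. *)

theory Defs
  imports "HOL-Algebra.Group_Action" "HOL-Library.FuncSet" "HOL-Library.Infinite_Typeclass"
begin

section \<open>Categories, functors, natural transformations\<close>

text \<open>
  Categories are given by a family of hom-sets, which need not be disjoint.
  \<open>Comp C x y z g f\<close> is the composite of \<open>f : x \<rightarrow> y\<close> followed by \<open>g : y \<rightarrow> z\<close>.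
\<close>

record ('o, 'm) cat =
  Obj :: "'o set"
  Hom :: "'o \<Rightarrow> 'o \<Rightarrow> 'm set"
  Idn :: "'o \<Rightarrow> 'm"
  Comp :: "'o \<Rightarrow> 'o \<Rightarrow> 'o \<Rightarrow> 'm \<Rightarrow> 'm \<Rightarrow> 'm"

locale category =
  fixes C :: "('o, 'm) cat"
  assumes Idn_Hom: "x \<in> Obj C \<Longrightarrow> Idn C x \<in> Hom C x x"
    and Comp_Hom: "\<lbrakk>x \<in> Obj C; y \<in> Obj C; z \<in> Obj C; f \<in> Hom C x y; g \<in> Hom C y z\<rbrakk>
      \<Longrightarrow> Comp C x y z g f \<in> Hom C x z"
    and Comp_Idn_left: "\<lbrakk>x \<in> Obj C; y \<in> Obj C; f \<in> Hom C x y\<rbrakk>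
      \<Longrightarrow> Comp C x y y (Idn C y) f = f"
    and Comp_Idn_right: "\<lbrakk>x \<in> Obj C; y \<in> Obj C; f \<in> Hom C x y\<rbrakk>
      \<Longrightarrow> Comp C x x y f (Idn C x) = f"
    and Comp_assoc: "\<lbrakk>w \<in> Obj C; x \<in> Obj C; y \<in> Obj C; z \<in> Obj C;
        f \<in> Hom C w x; g \<in> Hom C x y; h \<in> Hom C y z\<rbrakk>
      \<Longrightarrow> Comp C w x z (Comp C x y z h g) f = Comp C w y z h (Comp C w x y g f)"

definition is_iso :: "('o, 'm) cat \<Rightarrow> 'o \<Rightarrow> 'o \<Rightarrow> 'm \<Rightarrow> bool" where
  "is_iso C x y f \<longleftrightarrow> f \<in> Hom C x y \<and>
    (\<exists>g\<in>Hom C y x. Comp C x y x g f = Idn C x \<and> Comp C y x y f g = Idn C y)"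

definition finite_groupoid :: "('o, 'm) cat \<Rightarrow> bool" where
  "finite_groupoid C \<longleftrightarrow> category C \<and> finite (Obj C) \<and>
    (\<forall>x\<in>Obj C. \<forall>y\<in>Obj C. finite (Hom C x y) \<and> (\<forall>f\<in>Hom C x y. is_iso C x y f))"

definition prod_cat :: "('o, 'm) cat \<Rightarrow> ('p, 'n) cat \<Rightarrow> ('o \<times> 'p, 'm \<times> 'n) cat" where
  "prod_cat C D = \<lparr>
    Obj = Obj C \<times> Obj D,
    Hom = (\<lambda>x y. Hom C (fst x) (fst y) \<times> Hom D (snd x) (snd y)),
    Idn = (\<lambda>x. (Idn C (fst x), Idn D (snd x))),
    Comp = (\<lambda>x y z g f. (Comp C (fst x) (fst y) (fst z) (fst g) (fst f),
                         Comp D (snd x) (snd y) (snd z) (snd g) (snd f)))\<rparr>"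

text \<open>Since hom-sets may overlap, the arrow part of a functor is indexed by source and target.\<close>

record ('o, 'm, 'p, 'n) ftor =
  fobj :: "'o \<Rightarrow> 'p"
  fmor :: "'o \<Rightarrow> 'o \<Rightarrow> 'm \<Rightarrow> 'n"

locale cat_functor = C: category C + D: category D
  for C :: "('o, 'm) cat" and D :: "('p, 'n) cat" +
  fixes F :: "('o, 'm, 'p, 'n) ftor"
  assumes fobj_Obj: "x \<in> Obj C \<Longrightarrow> fobj F x \<in> Obj D"
    and fmor_Hom: "\<lbrakk>x \<in> Obj C; y \<in> Obj C; f \<in> Hom C x y\<rbrakk>
      \<Longrightarrow> fmor F x y f \<in> Hom D (fobj F x) (fobj F y)"
    and fmor_Idn: "x \<in> Obj C \<Longrightarrow> fmor F x x (Idn C x) = Idn D (fobj F x)"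
    and fmor_Comp: "\<lbrakk>x \<in> Obj C; y \<in> Obj C; z \<in> Obj C; f \<in> Hom C x y; g \<in> Hom C y z\<rbrakk>
      \<Longrightarrow> fmor F x z (Comp C x y z g f) =
          Comp D (fobj F x) (fobj F y) (fobj F z) (fmor F y z g) (fmor F x y f)"

text \<open>
  Extensionality makes functors that agree on their domain equal; it is imposed where
  functors are the objects of a functor category.
\<close>

definition ext_functor :: "('o, 'm) cat \<Rightarrow> ('o, 'm, 'p, 'n) ftor \<Rightarrow> bool" where
  "ext_functor C F \<longleftrightarrow> fobj F \<in> extensional (Obj C) \<and> fmor F \<in> extensional (Obj C) \<and>
    (\<forall>x\<in>Obj C. fmor F x \<in> extensional (Obj C) \<and>
      (\<forall>y\<in>Obj C. fmor F x y \<in> extensional (Hom C x y)))"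

definition id_ftor :: "('o, 'm) cat \<Rightarrow> ('o, 'm, 'o, 'm) ftor" where
  "id_ftor C = \<lparr>
    fobj = (\<lambda>x\<in>Obj C. x),
    fmor = (\<lambda>x\<in>Obj C. \<lambda>y\<in>Obj C. \<lambda>f\<in>Hom C x y. f)\<rparr>"

definition comp_ftor ::
    "('o, 'm) cat \<Rightarrow> ('p, 'n, 'q, 'l) ftor \<Rightarrow> ('o, 'm, 'p, 'n) ftor \<Rightarrow> ('o, 'm, 'q, 'l) ftor" where
  "comp_ftor C G F = \<lparr>
    fobj = (\<lambda>x\<in>Obj C. fobj G (fobj F x)),
    fmor = (\<lambda>x\<in>Obj C. \<lambda>y\<in>Obj C. \<lambda>f\<in>Hom C x y. fmor G (fobj F x) (fobj F y) (fmor F x y f))\<rparr>"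

definition nat_trans ::
    "('o, 'm) cat \<Rightarrow> ('p, 'n) cat \<Rightarrow> ('o, 'm, 'p, 'n) ftor \<Rightarrow> ('o, 'm, 'p, 'n) ftor
      \<Rightarrow> ('o \<Rightarrow> 'n) \<Rightarrow> bool" where
  "nat_trans C D F F' \<eta> \<longleftrightarrow>
    (\<forall>x\<in>Obj C. \<eta> x \<in> Hom D (fobj F x) (fobj F' x)) \<and>
    (\<forall>x\<in>Obj C. \<forall>y\<in>Obj C. \<forall>f\<in>Hom C x y.
      Comp D (fobj F x) (fobj F y) (fobj F' y) (\<eta> y) (fmor F x y f) =
      Comp D (fobj F x) (fobj F' x) (fobj F' y) (fmor F' x y f) (\<eta> x))"

definition nat_iso ::
    "('o, 'm) cat \<Rightarrow> ('p, 'n) cat \<Rightarrow> ('o, 'm, 'p, 'n) ftor \<Rightarrow> ('o, 'm, 'p, 'n) ftor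
      \<Rightarrow> ('o \<Rightarrow> 'n) \<Rightarrow> bool" where
  "nat_iso C D F F' \<eta> \<longleftrightarrow> nat_trans C D F F' \<eta> \<and>
    (\<forall>x\<in>Obj C. is_iso D (fobj F x) (fobj F' x) (\<eta> x))"

definition equivalence_of_categories ::
    "('o, 'm) cat \<Rightarrow> ('p, 'n) cat \<Rightarrow> ('o, 'm, 'p, 'n) ftor \<Rightarrow> bool" where
  "equivalence_of_categories C D F \<longleftrightarrow> cat_functor C D F \<and>
    (\<exists>G. cat_functor D C G \<and>
      (\<exists>\<eta>. nat_iso C C (id_ftor C) (comp_ftor C G F) \<eta>) \<and>
      (\<exists>\<epsilon>. nat_iso D D (comp_ftor D F G) (id_ftor D) \<epsilon>))"

definition functor_cat ::
    "('o, 'm) cat \<Rightarrow> ('p, 'n) cat \<Rightarrow> (('o, 'm, 'p, 'n) ftor, 'o \<Rightarrow> 'n) cat" where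
  "functor_cat C D = \<lparr>
    Obj = {F. cat_functor C D F \<and> ext_functor C F},
    Hom = (\<lambda>F F'. {\<eta> \<in> extensional (Obj C). nat_trans C D F F' \<eta>}),
    Idn = (\<lambda>F. \<lambda>x\<in>Obj C. Idn D (fobj F x)),
    Comp = (\<lambda>F F' F'' \<eta>' \<eta>. \<lambda>x\<in>Obj C. Comp D (fobj F x) (fobj F' x) (fobj F'' x) (\<eta>' x) (\<eta> x))\<rparr>"


section \<open>Strict 2-categories, strict 2-functors, biequivalences\<close>

text \<open>
  \<open>Hcomp T a b c\<close> is the composition functor
  \<open>Homc T b c \<times> Homc T a b \<rightarrow> Homc T a c\<close>; \<open>comp1\<close> and \<open>comp2\<close> are its object and arrow parts,
  so \<open>comp2 T a b c g g' f f' \<rho> \<epsilon>\<close> is the horizontal composite of \<open>\<epsilon> : f \<Rightarrow> f'\<close> and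
  \<open>\<rho> : g \<Rightarrow> g'\<close>.
\<close>

record ('a, 'b, 'c) two_cat =
  Cells0 :: "'a set"
  Homc :: "'a \<Rightarrow> 'a \<Rightarrow> ('b, 'c) cat"
  Id1 :: "'a \<Rightarrow> 'b"
  Hcomp :: "'a \<Rightarrow> 'a \<Rightarrow> 'a \<Rightarrow> ('b \<times> 'b, 'c \<times> 'c, 'b, 'c) ftor"

abbreviation comp1 :: "('a, 'b, 'c) two_cat \<Rightarrow> 'a \<Rightarrow> 'a \<Rightarrow> 'a \<Rightarrow> 'b \<Rightarrow> 'b \<Rightarrow> 'b" where
  "comp1 T a b c g f \<equiv> fobj (Hcomp T a b c) (g, f)"

abbreviation comp2 ::
    "('a, 'b, 'c) two_cat \<Rightarrow> 'a \<Rightarrow> 'a \<Rightarrow> 'a \<Rightarrow> 'b \<Rightarrow> 'b \<Rightarrow> 'b \<Rightarrow> 'b \<Rightarrow> 'c \<Rightarrow> 'c \<Rightarrow> 'c" where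
  "comp2 T a b c g g' f f' \<rho> \<epsilon> \<equiv> fmor (Hcomp T a b c) (g, f) (g', f') (\<rho>, \<epsilon>)"

abbreviation Id2 :: "('a, 'b, 'c) two_cat \<Rightarrow> 'a \<Rightarrow> 'a \<Rightarrow> 'b \<Rightarrow> 'c" where
  "Id2 T a b f \<equiv> Idn (Homc T a b) f"

locale two_category =
  fixes T :: "('a, 'b, 'c) two_cat"
  assumes Homc_category: "\<lbrakk>a \<in> Cells0 T; b \<in> Cells0 T\<rbrakk> \<Longrightarrow> category (Homc T a b)"
    and Id1_Homc: "a \<in> Cells0 T \<Longrightarrow> Id1 T a \<in> Obj (Homc T a a)"
    and Hcomp_functor: "\<lbrakk>a \<in> Cells0 T; b \<in> Cells0 T; c \<in> Cells0 T\<rbrakk>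
      \<Longrightarrow> cat_functor (prod_cat (Homc T b c) (Homc T a b)) (Homc T a c) (Hcomp T a b c)"
    and comp1_assoc: "\<lbrakk>a \<in> Cells0 T; b \<in> Cells0 T; c \<in> Cells0 T; d \<in> Cells0 T;
        f \<in> Obj (Homc T a b); g \<in> Obj (Homc T b c); h \<in> Obj (Homc T c d)\<rbrakk>
      \<Longrightarrow> comp1 T a b d (comp1 T b c d h g) f = comp1 T a c d h (comp1 T a b c g f)"
    and comp2_assoc: "\<lbrakk>a \<in> Cells0 T; b \<in> Cells0 T; c \<in> Cells0 T; d \<in> Cells0 T;
        f \<in> Obj (Homc T a b); f' \<in> Obj (Homc T a b); \<epsilon> \<in> Hom (Homc T a b) f f';
        g \<in> Obj (Homc T b c); g' \<in> Obj (Homc T b c); \<rho> \<in> Hom (Homc T b c) g g';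
        h \<in> Obj (Homc T c d); h' \<in> Obj (Homc T c d); \<sigma> \<in> Hom (Homc T c d) h h'\<rbrakk>
      \<Longrightarrow> comp2 T a b d (comp1 T b c d h g) (comp1 T b c d h' g') f f'
            (comp2 T b c d h h' g g' \<sigma> \<rho>) \<epsilon> =
          comp2 T a c d h h' (comp1 T a b c g f) (comp1 T a b c g' f')
            \<sigma> (comp2 T a b c g g' f f' \<rho> \<epsilon>)"
    and comp1_Id1_left: "\<lbrakk>a \<in> Cells0 T; b \<in> Cells0 T; f \<in> Obj (Homc T a b)\<rbrakk>
      \<Longrightarrow> comp1 T a b b (Id1 T b) f = f"
    and comp1_Id1_right: "\<lbrakk>a \<in> Cells0 T; b \<in> Cells0 T; f \<in> Obj (Homc T a b)\<rbrakk>
      \<Longrightarrow> comp1 T a a b f (Id1 T a) = f"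
    and comp2_Id2_left: "\<lbrakk>a \<in> Cells0 T; b \<in> Cells0 T;
        f \<in> Obj (Homc T a b); f' \<in> Obj (Homc T a b); \<epsilon> \<in> Hom (Homc T a b) f f'\<rbrakk>
      \<Longrightarrow> comp2 T a b b (Id1 T b) (Id1 T b) f f' (Id2 T b b (Id1 T b)) \<epsilon> = \<epsilon>"
    and comp2_Id2_right: "\<lbrakk>a \<in> Cells0 T; b \<in> Cells0 T;
        f \<in> Obj (Homc T a b); f' \<in> Obj (Homc T a b); \<epsilon> \<in> Hom (Homc T a b) f f'\<rbrakk>
      \<Longrightarrow> comp2 T a a b f f' (Id1 T a) (Id1 T a) \<epsilon> (Id2 T a a (Id1 T a)) = \<epsilon>"

record ('a, 'b, 'c, 'd, 'e, 'f) two_ftor =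
  map0 :: "'a \<Rightarrow> 'd"
  mapc :: "'a \<Rightarrow> 'a \<Rightarrow> ('b, 'c, 'e, 'f) ftor"

locale strict_two_functor = S: two_category S + T: two_category T
  for S :: "('a, 'b, 'c) two_cat" and T :: "('d, 'e, 'f) two_cat" +
  fixes P :: "('a, 'b, 'c, 'd, 'e, 'f) two_ftor"
  assumes map0_Cells0: "a \<in> Cells0 S \<Longrightarrow> map0 P a \<in> Cells0 T"
    and mapc_functor: "\<lbrakk>a \<in> Cells0 S; b \<in> Cells0 S\<rbrakk>
      \<Longrightarrow> cat_functor (Homc S a b) (Homc T (map0 P a) (map0 P b)) (mapc P a b)"
    and map1_Id1: "a \<in> Cells0 S \<Longrightarrow> fobj (mapc P a a) (Id1 S a) = Id1 T (map0 P a)"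
    and map1_comp1: "\<lbrakk>a \<in> Cells0 S; b \<in> Cells0 S; c \<in> Cells0 S;
        f \<in> Obj (Homc S a b); g \<in> Obj (Homc S b c)\<rbrakk>
      \<Longrightarrow> fobj (mapc P a c) (comp1 S a b c g f) =
          comp1 T (map0 P a) (map0 P b) (map0 P c) (fobj (mapc P b c) g) (fobj (mapc P a b) f)"
    and map2_comp2: "\<lbrakk>a \<in> Cells0 S; b \<in> Cells0 S; c \<in> Cells0 S;
        f \<in> Obj (Homc S a b); f' \<in> Obj (Homc S a b); \<epsilon> \<in> Hom (Homc S a b) f f';
        g \<in> Obj (Homc S b c); g' \<in> Obj (Homc S b c); \<rho> \<in> Hom (Homc S b c) g g'\<rbrakk>
      \<Longrightarrow> fmor (mapc P a c) (comp1 S a b c g f) (comp1 S a b c g' f')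
            (comp2 S a b c g g' f f' \<rho> \<epsilon>) =
          comp2 T (map0 P a) (map0 P b) (map0 P c)
            (fobj (mapc P b c) g) (fobj (mapc P b c) g') (fobj (mapc P a b) f) (fobj (mapc P a b) f')
            (fmor (mapc P b c) g g' \<rho>) (fmor (mapc P a b) f f' \<epsilon>)"

definition equivalent_cells0 :: "('a, 'b, 'c) two_cat \<Rightarrow> 'a \<Rightarrow> 'a \<Rightarrow> bool" where
  "equivalent_cells0 T a b \<longleftrightarrow>
    (\<exists>f\<in>Obj (Homc T a b). \<exists>g\<in>Obj (Homc T b a).
      (\<exists>\<eta>. is_iso (Homc T a a) (Id1 T a) (comp1 T a b a g f) \<eta>) \<and>
      (\<exists>\<epsilon>. is_iso (Homc T b b) (comp1 T b a b f g) (Id1 T b) \<epsilon>))"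

definition biequivalence ::
    "('a, 'b, 'c) two_cat \<Rightarrow> ('d, 'e, 'f) two_cat \<Rightarrow> ('a, 'b, 'c, 'd, 'e, 'f) two_ftor \<Rightarrow> bool" where
  "biequivalence S T P \<longleftrightarrow> strict_two_functor S T P \<and>
    (\<forall>a\<in>Cells0 S. \<forall>b\<in>Cells0 S.
      equivalence_of_categories (Homc S a b) (Homc T (map0 P a) (map0 P b)) (mapc P a b)) \<and>
    (\<forall>d\<in>Cells0 T. \<exists>a\<in>Cells0 S. equivalent_cells0 T (map0 P a) d)"


section \<open>The 2-category of finite groupoids\<close>

text \<open>
  The horizontal composite of \<open>\<epsilon> : F \<Rightarrow> F'\<close> and \<open>\<rho> : K \<Rightarrow> K'\<close> is the vertical composite of
  \<open>K \<epsilon> : K F \<Rightarrow> K F'\<close> and \<open>\<rho> F' : K F' \<Rightarrow> K' F'\<close>.  The types \<open>'x\<close> and \<open>'g\<close> act as universes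
  for objects and arrows; when both are infinite, every finite groupoid (over any types) is
  isomorphic to one in this universe.
\<close>

definition finGpd :: "(('x, 'g) cat, ('x, 'g, 'x, 'g) ftor, 'x \<Rightarrow> 'g) two_cat" where
  "finGpd = \<lparr>
    Cells0 = {C. finite_groupoid C},
    Homc = functor_cat,
    Id1 = id_ftor,
    Hcomp = (\<lambda>A B C. \<lparr>
      fobj = (\<lambda>(K, F). comp_ftor A K F),
      fmor = (\<lambda>(K, F) (K', F') (\<rho>, \<epsilon>). \<lambda>x\<in>Obj A.
        Comp C (fobj K (fobj F x)) (fobj K (fobj F' x)) (fobj K' (fobj F' x))
          (\<rho> (fobj F' x)) (fmor K (fobj F x) (fobj F' x) (\<epsilon> x)))\<rparr>)\<rparr>"


section \<open>The 2-category of finite sets with finite group actions\<close>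

record ('x, 'g) gset =
  grp :: "'g monoid"
  pts :: "'x set"
  act :: "'g \<Rightarrow> 'x \<Rightarrow> 'x"

definition finite_gset :: "('x, 'g) gset \<Rightarrow> bool" where
  "finite_gset A \<longleftrightarrow> group_action (grp A) (pts A) (act A) \<and> finite (carrier (grp A)) \<and> finite (pts A)"

record ('x, 'g) gmap =
  pmap :: "'x \<Rightarrow> 'x"
  gmap :: "'x \<Rightarrow> 'g \<Rightarrow> 'g"

text \<open>
  All component functions are extensional, so that cells which agree on their domains are equal.
\<close>

definition S_cells1 :: "('x, 'g) gset \<Rightarrow> ('x, 'g) gset \<Rightarrow> ('x, 'g) gmap set" where
  "S_cells1 A B = {f.
    pmap f \<in> pts A \<rightarrow>\<^sub>E pts B \<and>
    gmap f \<in> pts A \<rightarrow>\<^sub>E (carrier (grp A) \<rightarrow>\<^sub>E carrier (grp B)) \<and>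
    (\<forall>x\<in>pts A. \<forall>g\<in>carrier (grp A).
      pmap f (act A g x) = act B (gmap f x g) (pmap f x)) \<and>
    (\<forall>x\<in>pts A. \<forall>g\<in>carrier (grp A). \<forall>g'\<in>carrier (grp A).
      gmap f x (g \<otimes>\<^bsub>grp A\<^esub> g') = gmap f (act A g' x) g \<otimes>\<^bsub>grp B\<^esub> gmap f x g')}"

definition S_cells2 ::
    "('x, 'g) gset \<Rightarrow> ('x, 'g) gset \<Rightarrow> ('x, 'g) gmap \<Rightarrow> ('x, 'g) gmap \<Rightarrow> ('x \<Rightarrow> 'g) set" where
  "S_cells2 A B f f' = {\<epsilon>.
    \<epsilon> \<in> pts A \<rightarrow>\<^sub>E carrier (grp B) \<and>
    (\<forall>x\<in>pts A. pmap f' x = act B (\<epsilon> x) (pmap f x)) \<and>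
    (\<forall>x\<in>pts A. \<forall>g\<in>carrier (grp A).
      \<epsilon> (act A g x) \<otimes>\<^bsub>grp B\<^esub> gmap f x g \<otimes>\<^bsub>grp B\<^esub> inv\<^bsub>grp B\<^esub> (\<epsilon> x) = gmap f' x g)}"

definition S_vcomp :: "('x, 'g) gset \<Rightarrow> ('x, 'g) gset \<Rightarrow> ('x \<Rightarrow> 'g) \<Rightarrow> ('x \<Rightarrow> 'g) \<Rightarrow> 'x \<Rightarrow> 'g" where
  "S_vcomp A B \<epsilon>' \<epsilon> = (\<lambda>x\<in>pts A. \<epsilon>' x \<otimes>\<^bsub>grp B\<^esub> \<epsilon> x)"

definition S_homc :: "('x, 'g) gset \<Rightarrow> ('x, 'g) gset \<Rightarrow> (('x, 'g) gmap, 'x \<Rightarrow> 'g) cat" where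
  "S_homc A B = \<lparr>
    Obj = S_cells1 A B,
    Hom = S_cells2 A B,
    Idn = (\<lambda>f. \<lambda>x\<in>pts A. \<one>\<^bsub>grp B\<^esub>),
    Comp = (\<lambda>f f' f'' \<epsilon>' \<epsilon>. S_vcomp A B \<epsilon>' \<epsilon>)\<rparr>"

definition S_id1 :: "('x, 'g) gset \<Rightarrow> ('x, 'g) gmap" where
  "S_id1 A = \<lparr>pmap = (\<lambda>x\<in>pts A. x), gmap = (\<lambda>x\<in>pts A. \<lambda>g\<in>carrier (grp A). g)\<rparr>"

definition S_comp1 :: "('x, 'g) gset \<Rightarrow> ('x, 'g) gmap \<Rightarrow> ('x, 'g) gmap \<Rightarrow> ('x, 'g) gmap" where
  "S_comp1 A k f = \<lparr>
    pmap = (\<lambda>x\<in>pts A. pmap k (pmap f x)),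
    gmap = (\<lambda>x\<in>pts A. \<lambda>g\<in>carrier (grp A). gmap k (pmap f x) (gmap f x g))\<rparr>"

definition S_whisker_left ::
    "('x, 'g) gset \<Rightarrow> ('x, 'g) gmap \<Rightarrow> ('x, 'g) gmap \<Rightarrow> ('x \<Rightarrow> 'g) \<Rightarrow> 'x \<Rightarrow> 'g" where
  \<comment> \<open>\<open>k \<circ> \<epsilon>\<close> for \<open>\<epsilon> : f \<Rightarrow> f'\<close>\<close>
  "S_whisker_left A k f \<epsilon> = (\<lambda>x\<in>pts A. gmap k (pmap f x) (\<epsilon> x))"

definition S_whisker_right ::
    "('x, 'g) gset \<Rightarrow> ('x \<Rightarrow> 'g) \<Rightarrow> ('x, 'g) gmap \<Rightarrow> 'x \<Rightarrow> 'g" where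
  \<comment> \<open>\<open>\<rho> \<circ> f\<close>\<close>
  "S_whisker_right A \<rho> f = (\<lambda>x\<in>pts A. \<rho> (pmap f x))"

text \<open>
  As in \<open>finGpd\<close>, the horizontal composite of \<open>\<epsilon> : f \<Rightarrow> f'\<close> and \<open>\<rho> : k \<Rightarrow> k'\<close> is
  \<open>(\<rho> \<circ> f') \<cdot> (k \<circ> \<epsilon>)\<close>; whiskering is recovered by taking \<open>\<rho>\<close> or \<open>\<epsilon>\<close> to be an identity.
\<close>

definition S2 :: "(('x, 'g) gset, ('x, 'g) gmap, 'x \<Rightarrow> 'g) two_cat" where
  "S2 = \<lparr>
    Cells0 = {A. finite_gset A},
    Homc = S_homc,
    Id1 = S_id1,
    Hcomp = (\<lambda>A B C. \<lparr>
      fobj = (\<lambda>(k, f). S_comp1 A k f),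
      fmor = (\<lambda>(k, f) (k', f') (\<rho>, \<epsilon>).
        S_vcomp A C (S_whisker_right A \<rho> f') (S_whisker_left A k f \<epsilon>))\<rparr>)\<rparr>"


section \<open>The 2-functor from group actions to groupoids\<close>

definition action_groupoid :: "('x, 'g) gset \<Rightarrow> ('x, 'g) cat" where
  "action_groupoid A = \<lparr>
    Obj = pts A,
    Hom = (\<lambda>x x'. {g \<in> carrier (grp A). act A g x = x'}),
    Idn = (\<lambda>x. \<one>\<^bsub>grp A\<^esub>),
    Comp = (\<lambda>x y z h g. h \<otimes>\<^bsub>grp A\<^esub> g)\<rparr>"

definition action_ftor :: "('x, 'g) gset \<Rightarrow> ('x, 'g) gmap \<Rightarrow> ('x, 'g, 'x, 'g) ftor" where
  "action_ftor A f = \<lparr>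
    fobj = (\<lambda>x\<in>pts A. pmap f x),
    fmor = (\<lambda>x\<in>pts A. \<lambda>y\<in>pts A. \<lambda>g\<in>Hom (action_groupoid A) x y. gmap f x g)\<rparr>"

definition E2 ::
    "(('x, 'g) gset, ('x, 'g) gmap, 'x \<Rightarrow> 'g, ('x, 'g) cat, ('x, 'g, 'x, 'g) ftor, 'x \<Rightarrow> 'g) two_ftor"
  where
  "E2 = \<lparr>
    map0 = action_groupoid,
    mapc = (\<lambda>A B. \<lparr>
      fobj = action_ftor A,
      fmor = (\<lambda>f f' \<epsilon>. \<lambda>x\<in>pts A. \<epsilon> x)\<rparr>)\<rparr>"

end

theory Submission
  imports Defs "HOL-Algebra.Product_Groups"
begin

text \<open>
  A 1-cell of \<open>S2\<close> is determined by its functor of action groupoids, and the 2-cells between two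
  1-cells are literally the natural transformations between their functors, so \<open>E2\<close> is an
  isomorphism on hom-categories and the laws of \<open>S2\<close> are inherited from those of \<open>finGpd\<close>.

  Given a finite groupoid, choose one representative \<open>r\<close> in each connected component and let
  \<open>G = \<Prod>r. Aut r\<close> act on the disjoint union of the coset spaces \<open>G / Aut r\<close>.  This action has one
  orbit per component, with stabiliser \<open>Aut r\<close>, so conjugation with chosen arrows \<open>r \<rightarrow> x\<close> gives a
  fully faithful and essentially surjective functor to the action groupoid.
\<close>

section \<open>The 2-category of finite groupoids\<close>

text \<open>A 0-cell carries a single group, while the components of a groupoid may have unrelated
  automorphism groups. This is the reason for the product: each \<open>Aut r\<close> is one of its
  factors, so one group can have all of them as stabilisers. The price is that an orbit may have
  several points, but each of them is isomorphic to the base point of its orbit. Conversely, all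
  objects of a component are sent to the same base point. The functor is therefore in general
  neither injective nor surjective on objects, and the result is an equivalence rather than an
  isomorphism. A second obstacle is typing. The construction yields points of type
  \<open>'a \<times> ('a \<Rightarrow> 'b)\<close> and group elements of type
  \<open>'a \<Rightarrow> 'b\<close>, both dictated by the groupoid, whereas the 0-cells have to
  live over prescribed infinite types. Finiteness allows the points and the group elements to be
  relabelled injectively in those types.\<close>

lemma ftor_eqI:
  assumes "ext_functor C F" "ext_functor C F'"
    and "\<And>x. x \<in> Obj C \<Longrightarrow> fobj F x = fobj F' x"
    and "\<And>x y f. \<lbrakk>x \<in> Obj C; y \<in> Obj C; f \<in> Hom C x y\<rbrakk> \<Longrightarrow> fmor F x y f = fmor F' x y f"
  shows "F = F'"
proof -
  have o: "fobj F = fobj F'"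
    using assms by (intro extensionalityI[of _ "Obj C"]) (auto simp: ext_functor_def)
  have m: "fmor F = fmor F'"
  proof (rule extensionalityI[of _ "Obj C"])
    fix x assume x: "x \<in> Obj C"
    show "fmor F x = fmor F' x"
    proof (rule extensionalityI[of _ "Obj C"])
      fix y assume y: "y \<in> Obj C"
      show "fmor F x y = fmor F' x y"
        using assms x y by (intro extensionalityI[of _ "Hom C x y"]) (auto simp: ext_functor_def)
    qed (use assms x in \<open>auto simp: ext_functor_def\<close>)
  qed (use assms in \<open>auto simp: ext_functor_def\<close>)
  show ?thesis using o m by simp
qed

lemma ext_functor_id_ftor: "ext_functor C (id_ftor C)"
  by (auto simp: ext_functor_def id_ftor_def)

lemma ext_functor_comp_ftor: "ext_functor C (comp_ftor C G F)"
  by (auto simp: ext_functor_def comp_ftor_def)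

lemma id_ftor_simps [simp]:
  "x \<in> Obj C \<Longrightarrow> fobj (id_ftor C) x = x"
  "\<lbrakk>x \<in> Obj C; y \<in> Obj C; f \<in> Hom C x y\<rbrakk> \<Longrightarrow> fmor (id_ftor C) x y f = f"
  by (auto simp: id_ftor_def)

lemma comp_ftor_simps [simp]:
  "x \<in> Obj C \<Longrightarrow> fobj (comp_ftor C G F) x = fobj G (fobj F x)"
  "\<lbrakk>x \<in> Obj C; y \<in> Obj C; f \<in> Hom C x y\<rbrakk>
    \<Longrightarrow> fmor (comp_ftor C G F) x y f = fmor G (fobj F x) (fobj F y) (fmor F x y f)"
  by (auto simp: comp_ftor_def)

lemma cat_functor_id_ftor:
  assumes "category C" shows "cat_functor C C (id_ftor C)"
proof -
  interpret category C by fact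
  show ?thesis by unfold_locales (auto simp: Idn_Hom Comp_Hom)
qed

lemma cat_functor_comp_ftor:
  assumes "cat_functor C D F" "cat_functor D E G"
  shows "cat_functor C E (comp_ftor C G F)"
proof -
  interpret F: cat_functor C D F by fact
  interpret G: cat_functor D E G by fact
  show ?thesis
    by unfold_locales
      (auto simp: F.fobj_Obj G.fobj_Obj F.fmor_Hom G.fmor_Hom F.fmor_Idn G.fmor_Idn
        F.fmor_Comp G.fmor_Comp F.C.Idn_Hom F.C.Comp_Hom)
qed

section \<open>Functor categories and vertical composition\<close>

lemma functor_cat_simps [simp]:
  "Obj (functor_cat C D) = {F. cat_functor C D F \<and> ext_functor C F}"
  "Hom (functor_cat C D) F F' = {\<eta> \<in> extensional (Obj C). nat_trans C D F F' \<eta>}"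
  "Idn (functor_cat C D) F = (\<lambda>x\<in>Obj C. Idn D (fobj F x))"
  "Comp (functor_cat C D) F F' F'' \<eta>' \<eta> =
    (\<lambda>x\<in>Obj C. Comp D (fobj F x) (fobj F' x) (fobj F'' x) (\<eta>' x) (\<eta> x))"
  by (simp_all add: functor_cat_def)

lemma nat_transD:
  assumes "nat_trans C D F F' \<eta>" "x \<in> Obj C"
  shows "\<eta> x \<in> Hom D (fobj F x) (fobj F' x)"
  using assms by (simp add: nat_trans_def)

lemma nat_trans_natural:
  assumes "nat_trans C D F F' \<eta>" "x \<in> Obj C" "y \<in> Obj C" "f \<in> Hom C x y"
  shows "Comp D (fobj F x) (fobj F y) (fobj F' y) (\<eta> y) (fmor F x y f) =
         Comp D (fobj F x) (fobj F' x) (fobj F' y) (fmor F' x y f) (\<eta> x)"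
  using assms by (simp add: nat_trans_def)

lemma nat_trans_Idn:
  assumes "cat_functor C D F"
  shows "nat_trans C D F F (\<lambda>x\<in>Obj C. Idn D (fobj F x))"
proof -
  interpret F: cat_functor C D F by fact
  show ?thesis
    by (auto simp: nat_trans_def F.fobj_Obj F.fmor_Hom F.D.Idn_Hom F.D.Comp_Idn_left
        F.D.Comp_Idn_right)
qed

text \<open>Pasting of two naturality squares: the image of \<open>f\<close> is moved past
  \<open>\<eta>\<close> and then past \<open>\<eta>'\<close>, with reassociations in
  between.\<close>

lemma nat_trans_Comp:
  assumes "cat_functor C D F" "cat_functor C D F'" "cat_functor C D F''"
    and n: "nat_trans C D F F' \<eta>" and n': "nat_trans C D F' F'' \<eta>'"
  shows "nat_trans C D F F''
    (\<lambda>x\<in>Obj C. Comp D (fobj F x) (fobj F' x) (fobj F'' x) (\<eta>' x) (\<eta> x))"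
proof -
  interpret F: cat_functor C D F by fact
  interpret F': cat_functor C D F' by fact
  interpret F'': cat_functor C D F'' by fact
  note [simp] = nat_transD[OF n] nat_transD[OF n'] F.fobj_Obj F'.fobj_Obj F''.fobj_Obj
    F.fmor_Hom F'.fmor_Hom F''.fmor_Hom F.D.Comp_Hom
  show ?thesis unfolding nat_trans_def
  proof (intro conjI ballI)
    fix x y f assume a [simp]: "x \<in> Obj C" "y \<in> Obj C" "f \<in> Hom C x y"
    let ?c = "Comp D"
    have "?c (fobj F x) (fobj F y) (fobj F'' y)
        (?c (fobj F y) (fobj F' y) (fobj F'' y) (\<eta>' y) (\<eta> y)) (fmor F x y f)
      = ?c (fobj F x) (fobj F' y) (fobj F'' y) (\<eta>' y)
          (?c (fobj F x) (fobj F y) (fobj F' y) (\<eta> y) (fmor F x y f))"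
      by (rule F.D.Comp_assoc) auto
    also have "\<dots> = ?c (fobj F x) (fobj F' y) (fobj F'' y) (\<eta>' y)
          (?c (fobj F x) (fobj F' x) (fobj F' y) (fmor F' x y f) (\<eta> x))"
      by (simp add: nat_trans_natural[OF n])
    also have "\<dots> = ?c (fobj F x) (fobj F' x) (fobj F'' y)
          (?c (fobj F' x) (fobj F' y) (fobj F'' y) (\<eta>' y) (fmor F' x y f)) (\<eta> x)"
      by (rule F.D.Comp_assoc[symmetric]) auto
    also have "\<dots> = ?c (fobj F x) (fobj F' x) (fobj F'' y)
          (?c (fobj F' x) (fobj F'' x) (fobj F'' y) (fmor F'' x y f) (\<eta>' x)) (\<eta> x)"
      by (simp add: nat_trans_natural[OF n'])
    also have "\<dots> = ?c (fobj F x) (fobj F'' x) (fobj F'' y) (fmor F'' x y f)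
          (?c (fobj F x) (fobj F' x) (fobj F'' x) (\<eta>' x) (\<eta> x))"
      by (rule F.D.Comp_assoc) auto
    finally show "?c (fobj F x) (fobj F y) (fobj F'' y)
        ((\<lambda>x\<in>Obj C. ?c (fobj F x) (fobj F' x) (fobj F'' x) (\<eta>' x) (\<eta> x)) y) (fmor F x y f) =
      ?c (fobj F x) (fobj F'' x) (fobj F'' y) (fmor F'' x y f)
        ((\<lambda>x\<in>Obj C. ?c (fobj F x) (fobj F' x) (fobj F'' x) (\<eta>' x) (\<eta> x)) x)"
      by simp
  qed auto
qed

lemma category_functor_cat:
  assumes "category C" "category D"
  shows "category (functor_cat C D)"
proof -
  interpret C: category C by fact
  interpret D: category D by fact
  have 1: "fobj F x \<in> Obj D" if "cat_functor C D F" "x \<in> Obj C" for F x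
    using cat_functor.fobj_Obj[OF that] .
  show ?thesis
    apply unfold_locales
    subgoal by (simp add: nat_trans_Idn)
    subgoal by (simp add: nat_trans_Comp)
    subgoal for F F' \<eta>
      by (auto intro!: extensionalityI[of _ "Obj C"] simp: 1 nat_transD D.Comp_Idn_left)
    subgoal for F F' \<eta>
      by (auto intro!: extensionalityI[of _ "Obj C"] simp: 1 nat_transD D.Comp_Idn_right)
    subgoal
      by (auto intro!: extensionalityI[of _ "Obj C"] D.Comp_assoc simp: 1 nat_transD)
    done
qed

section \<open>Horizontal composition and the interchange law\<close>

lemma prod_cat_simps [simp]:
  "Obj (prod_cat C D) = Obj C \<times> Obj D"
  "Hom (prod_cat C D) x y = Hom C (fst x) (fst y) \<times> Hom D (snd x) (snd y)"
  "Idn (prod_cat C D) x = (Idn C (fst x), Idn D (snd x))"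
  "Comp (prod_cat C D) x y z g f = (Comp C (fst x) (fst y) (fst z) (fst g) (fst f),
      Comp D (snd x) (snd y) (snd z) (snd g) (snd f))"
  by (simp_all add: prod_cat_def)

lemma category_prod_cat:
  assumes "category C" "category D"
  shows "category (prod_cat C D)"
proof -
  interpret C: category C by fact
  interpret D: category D by fact
  show ?thesis
    by unfold_locales
      (auto simp: C.Idn_Hom D.Idn_Hom C.Comp_Hom D.Comp_Hom C.Comp_Idn_left D.Comp_Idn_left
        C.Comp_Idn_right D.Comp_Idn_right C.Comp_assoc D.Comp_assoc)
qed

text \<open>The arrow part of \<open>Hcomp finGpd\<close>, detached from the record so that its laws
  can be stated for categories over different types.\<close>

definition hcomp_trans ::
    "('o, 'm) cat \<Rightarrow> ('q, 'l) cat \<Rightarrow> ('p, 'n, 'q, 'l) ftor \<Rightarrow> ('p, 'n, 'q, 'l) ftor \<Rightarrow>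
      ('o, 'm, 'p, 'n) ftor \<Rightarrow> ('o, 'm, 'p, 'n) ftor \<Rightarrow> ('p \<Rightarrow> 'l) \<Rightarrow> ('o \<Rightarrow> 'n) \<Rightarrow> 'o \<Rightarrow> 'l" where
  "hcomp_trans A C K K' F F' \<rho> \<epsilon> = (\<lambda>x\<in>Obj A.
    Comp C (fobj K (fobj F x)) (fobj K (fobj F' x)) (fobj K' (fobj F' x))
      (\<rho> (fobj F' x)) (fmor K (fobj F x) (fobj F' x) (\<epsilon> x)))"

lemma hcomp_trans_ext [simp]: "hcomp_trans A C K K' F F' \<rho> \<epsilon> \<in> extensional (Obj A)"
  by (simp add: hcomp_trans_def)

lemma hcomp_trans_apply [simp]:
  "x \<in> Obj A \<Longrightarrow> hcomp_trans A C K K' F F' \<rho> \<epsilon> x =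
    Comp C (fobj K (fobj F x)) (fobj K (fobj F' x)) (fobj K' (fobj F' x))
      (\<rho> (fobj F' x)) (fmor K (fobj F x) (fobj F' x) (\<epsilon> x))"
  by (simp add: hcomp_trans_def)

text \<open>\<open>K\<close> preserves the naturality squares of \<open>\<epsilon>\<close>. The
  family is left unrestricted, since \<open>nat_trans\<close> looks only at objects of
  \<open>A\<close>; extensionality enters with the composite \<open>hcomp_trans\<close>.\<close>

lemma nat_trans_whisker_left:
  assumes "cat_functor A B F" "cat_functor A B F'" "cat_functor B C K"
    and n: "nat_trans A B F F' \<epsilon>"
  shows "nat_trans A C (comp_ftor A K F) (comp_ftor A K F')
    (\<lambda>x. fmor K (fobj F x) (fobj F' x) (\<epsilon> x))"
proof -
  interpret F: cat_functor A B F by fact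
  interpret F': cat_functor A B F' by fact
  interpret K: cat_functor B C K by fact
  show ?thesis
    unfolding nat_trans_def
    by (auto simp: F.fobj_Obj F'.fobj_Obj F.fmor_Hom F'.fmor_Hom K.fmor_Hom nat_transD[OF n]
        K.fmor_Comp[symmetric] nat_trans_natural[OF n])
qed

lemma nat_trans_whisker_right:
  assumes "cat_functor A B F"
    and n: "nat_trans B C K K' \<rho>"
  shows "nat_trans A C (comp_ftor A K F) (comp_ftor A K' F) (\<lambda>x. \<rho> (fobj F x))"
proof -
  interpret F: cat_functor A B F by fact
  show ?thesis
    unfolding nat_trans_def
    by (auto simp: F.fobj_Obj F.fmor_Hom nat_transD[OF n] nat_trans_natural[OF n])
qed

text \<open>The family is the vertical composite of the two whiskerings \<open>K \<epsilon>\<close>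
  and \<open>\<rho> F'\<close>, so naturality is inherited from them.\<close>

lemma nat_trans_hcomp:
  assumes F: "cat_functor A B F" "cat_functor A B F'" and K: "cat_functor B C K" "cat_functor B C K'"
    and n: "nat_trans A B F F' \<epsilon>" "nat_trans B C K K' \<rho>"
  shows "nat_trans A C (comp_ftor A K F) (comp_ftor A K' F') (hcomp_trans A C K K' F F' \<rho> \<epsilon>)"
proof -
  have "nat_trans A C (comp_ftor A K F) (comp_ftor A K' F')
    (\<lambda>x\<in>Obj A. Comp C (fobj (comp_ftor A K F) x) (fobj (comp_ftor A K F') x)
      (fobj (comp_ftor A K' F') x) (\<rho> (fobj F' x)) (fmor K (fobj F x) (fobj F' x) (\<epsilon> x)))"
    by (intro nat_trans_Comp cat_functor_comp_ftor[OF F(1)] cat_functor_comp_ftor[OF F(2)]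
        nat_trans_whisker_left[OF F K(1) n(1)] nat_trans_whisker_right[OF F(2) n(2)] K)
  then show ?thesis by (simp add: hcomp_trans_def cong: restrict_cong)
qed

text \<open>The interchange law, at one object. Apart from associativity and the functoriality of
  \<open>K\<close>, the only input is naturality of \<open>\<rho>\<close> at the arrow
  \<open>\<epsilon>' x\<close>, which exchanges the two inner factors.\<close>

lemma hcomp_trans_Comp:
  assumes "cat_functor A B F" "cat_functor A B F'" "cat_functor A B F''"
    and "cat_functor B C K" "cat_functor B C K'" "cat_functor B C K''"
    and n: "nat_trans A B F F' \<epsilon>" "nat_trans A B F' F'' \<epsilon>'"
      "nat_trans B C K K' \<rho>" "nat_trans B C K' K'' \<rho>'"
    and x: "x \<in> Obj A"
  shows "hcomp_trans A C K K'' F F''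
      (\<lambda>y\<in>Obj B. Comp C (fobj K y) (fobj K' y) (fobj K'' y) (\<rho>' y) (\<rho> y))
      (\<lambda>x\<in>Obj A. Comp B (fobj F x) (fobj F' x) (fobj F'' x) (\<epsilon>' x) (\<epsilon> x)) x =
    Comp C (fobj K (fobj F x)) (fobj K' (fobj F' x)) (fobj K'' (fobj F'' x))
      (hcomp_trans A C K' K'' F' F'' \<rho>' \<epsilon>' x) (hcomp_trans A C K K' F F' \<rho> \<epsilon> x)"
proof -
  interpret F: cat_functor A B F by fact
  interpret F': cat_functor A B F' by fact
  interpret F'': cat_functor A B F'' by fact
  interpret K: cat_functor B C K by fact
  interpret K': cat_functor B C K' by fact
  interpret K'': cat_functor B C K'' by fact
  let ?a = "fobj F x" and ?b = "fobj F' x" and ?c = "fobj F'' x"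
  have [simp]: "?a \<in> Obj B" "?b \<in> Obj B" "?c \<in> Obj B" "x \<in> Obj A"
    using x by (auto simp: F.fobj_Obj F'.fobj_Obj F''.fobj_Obj)
  have [simp]: "\<epsilon> x \<in> Hom B ?a ?b" "\<epsilon>' x \<in> Hom B ?b ?c"
    using n x by (auto simp: nat_trans_def)
  note [simp] = nat_transD[OF n(3)] nat_transD[OF n(4)] K.fobj_Obj K'.fobj_Obj K''.fobj_Obj
    K.fmor_Hom K'.fmor_Hom K''.fmor_Hom K.D.Comp_Hom
  let ?m = "fmor K ?a ?b (\<epsilon> x)" and ?m' = "fmor K ?b ?c (\<epsilon>' x)" and ?m1 = "fmor K' ?b ?c (\<epsilon>' x)"
  let ?Ka = "fobj K ?a" and ?Kb = "fobj K ?b" and ?Kc = "fobj K ?c"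
  let ?Kb' = "fobj K' ?b" and ?Kc' = "fobj K' ?c" and ?Kc'' = "fobj K'' ?c"
  have "Comp C ?Ka ?Kc ?Kc'' (Comp C ?Kc ?Kc' ?Kc'' (\<rho>' ?c) (\<rho> ?c)) (Comp C ?Ka ?Kb ?Kc ?m' ?m)
      = Comp C ?Ka ?Kc' ?Kc'' (\<rho>' ?c) (Comp C ?Ka ?Kc ?Kc' (\<rho> ?c) (Comp C ?Ka ?Kb ?Kc ?m' ?m))"
    by (rule K.D.Comp_assoc) auto
  also have "Comp C ?Ka ?Kc ?Kc' (\<rho> ?c) (Comp C ?Ka ?Kb ?Kc ?m' ?m)
      = Comp C ?Ka ?Kb ?Kc' (Comp C ?Kb ?Kc ?Kc' (\<rho> ?c) ?m') ?m"
    by (rule K.D.Comp_assoc[symmetric]) auto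
  also have "Comp C ?Kb ?Kc ?Kc' (\<rho> ?c) ?m' = Comp C ?Kb ?Kb' ?Kc' ?m1 (\<rho> ?b)"
    by (rule nat_trans_natural[OF n(3)]) auto
  also have "Comp C ?Ka ?Kb ?Kc' (Comp C ?Kb ?Kb' ?Kc' ?m1 (\<rho> ?b)) ?m
      = Comp C ?Ka ?Kb' ?Kc' ?m1 (Comp C ?Ka ?Kb ?Kb' (\<rho> ?b) ?m)"
    by (rule K.D.Comp_assoc) auto
  also have "Comp C ?Ka ?Kc' ?Kc'' (\<rho>' ?c) (Comp C ?Ka ?Kb' ?Kc' ?m1 (Comp C ?Ka ?Kb ?Kb' (\<rho> ?b) ?m))
      = Comp C ?Ka ?Kb' ?Kc'' (Comp C ?Kb' ?Kc' ?Kc'' (\<rho>' ?c) ?m1) (Comp C ?Ka ?Kb ?Kb' (\<rho> ?b) ?m)"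
    by (rule K.D.Comp_assoc[symmetric]) auto
  finally show ?thesis by (simp add: K.fmor_Comp)
qed

lemma finGpd_simps [simp]:
  "Cells0 finGpd = {C. finite_groupoid C}"
  "Homc finGpd = functor_cat"
  "Id1 finGpd = id_ftor"
  "comp1 finGpd A B C K F = comp_ftor A K F"
  "comp2 finGpd A B C K K' F F' \<rho> \<epsilon> = hcomp_trans A C K K' F F' \<rho> \<epsilon>"
  by (simp_all add: finGpd_def hcomp_trans_def)

text \<open>\<open>id_ftor B\<close> is the identity only inside \<open>B\<close>, so
  \<open>F\<close> has to land there. For the identity on the other side, extensionality of
  \<open>F\<close> suffices.\<close>

lemma comp_ftor_id_left:
  assumes "cat_functor A B F" "ext_functor A F"
  shows "comp_ftor A (id_ftor B) F = F"
proof -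
  interpret F: cat_functor A B F by fact
  show ?thesis
    by (rule ftor_eqI[OF ext_functor_comp_ftor assms(2)]) (auto simp: F.fobj_Obj F.fmor_Hom)
qed

lemma comp_ftor_id_right:
  assumes "ext_functor A F"
  shows "comp_ftor A F (id_ftor A) = F"
  by (rule ftor_eqI[OF ext_functor_comp_ftor assms]) auto

lemma comp_ftor_assoc:
  assumes "cat_functor A B F"
  shows "comp_ftor A (comp_ftor B K H) F = comp_ftor A K (comp_ftor A H F)"
proof -
  interpret F: cat_functor A B F by fact
  show ?thesis
    by (rule ftor_eqI[OF ext_functor_comp_ftor ext_functor_comp_ftor]) (auto simp: F.fobj_Obj F.fmor_Hom)
qed

text \<open>At each object both sides are the same threefold composite in \<open>D\<close>, once
  \<open>H\<close> is distributed over the composite of \<open>\<rho>\<close> with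
  \<open>K \<epsilon>\<close>.\<close>

lemma hcomp_trans_assoc:
  assumes "cat_functor A B F" "cat_functor A B F'" "cat_functor B C K" "cat_functor B C K'"
    and "cat_functor C D H" "cat_functor C D H'"
    and n: "nat_trans A B F F' \<epsilon>" "nat_trans B C K K' \<rho>" "nat_trans C D H H' \<sigma>"
  shows "hcomp_trans A D (comp_ftor B H K) (comp_ftor B H' K') F F'
      (hcomp_trans B D H H' K K' \<sigma> \<rho>) \<epsilon> =
    hcomp_trans A D H H' (comp_ftor A K F) (comp_ftor A K' F') \<sigma> (hcomp_trans A C K K' F F' \<rho> \<epsilon>)"
proof (rule extensionalityI[OF hcomp_trans_ext hcomp_trans_ext])
  fix x assume x: "x \<in> Obj A"
  interpret F: cat_functor A B F by fact
  interpret F': cat_functor A B F' by fact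
  interpret K: cat_functor B C K by fact
  interpret K': cat_functor B C K' by fact
  interpret H: cat_functor C D H by fact
  interpret H': cat_functor C D H' by fact
  have \<epsilon>: "\<epsilon> x \<in> Hom B (fobj F x) (fobj F' x)" using n x by (auto simp: nat_trans_def)
  show "hcomp_trans A D (comp_ftor B H K) (comp_ftor B H' K') F F'
      (hcomp_trans B D H H' K K' \<sigma> \<rho>) \<epsilon> x =
    hcomp_trans A D H H' (comp_ftor A K F) (comp_ftor A K' F') \<sigma> (hcomp_trans A C K K' F F' \<rho> \<epsilon>) x"
    using x \<epsilon>
    by (simp add: F.fobj_Obj F'.fobj_Obj K.fobj_Obj K'.fobj_Obj H.fobj_Obj H'.fobj_Obj
        K.fmor_Hom H.fmor_Hom nat_transD[OF n(2)] nat_transD[OF n(3)] H.fmor_Comp H.D.Comp_assoc)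
qed

lemma cat_functor_Hcomp_finGpd:
  assumes "category A" "category B" "category C"
  shows "cat_functor (prod_cat (functor_cat B C) (functor_cat A B)) (functor_cat A C)
    (Hcomp finGpd A B C)"
proof -
  interpret A: category A by fact
  interpret B: category B by fact
  interpret C: category C by fact
  interpret P: category "prod_cat (functor_cat B C) (functor_cat A B)"
    by (intro category_prod_cat category_functor_cat assms)
  interpret Q: category "functor_cat A C"
    by (intro category_functor_cat assms)
  show ?thesis
    apply unfold_locales
    subgoal for p
      by (cases p) (auto intro: cat_functor_comp_ftor ext_functor_comp_ftor)
    subgoal for p q r
      by (cases p, cases q, cases r) (auto intro: nat_trans_hcomp)
    subgoal for p
      by (cases p) (auto intro!: extensionalityI[of _ "Obj A"] C.Comp_Idn_left
          simp: cat_functor.fobj_Obj cat_functor.fmor_Idn C.Idn_Hom C.Comp_Idn_left)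
    \<comment> \<open>Preservation of composition is the interchange law.
      \<open>hcomp_trans_apply\<close> is switched off so that the left side of
      \<open>hcomp_trans_Comp\<close> is still there to be matched.\<close>
    subgoal for p q r s t
      by (cases p, cases q, cases r, cases s, cases t)
        (auto intro!: extensionalityI[of _ "Obj A"]
          simp del: hcomp_trans_apply simp: hcomp_trans_Comp)
    done
qed

lemma two_category_finGpd: "two_category finGpd"
proof -
  have cat: "category A" if "finite_groupoid A" for A :: "('x, 'y) cat"
    using that by (simp add: finite_groupoid_def)
  show ?thesis
    apply (rule two_category.intro)
    subgoal by (simp add: category_functor_cat cat)
    subgoal by (simp add: cat_functor_id_ftor ext_functor_id_ftor cat)
    subgoal using cat_functor_Hcomp_finGpd[OF cat cat cat] by simp
    subgoal by (auto intro: comp_ftor_assoc)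
    subgoal by (simp add: hcomp_trans_assoc)
    subgoal by (simp add: comp_ftor_id_left)
    subgoal by (simp add: comp_ftor_id_right)
    subgoal for A B F F' \<epsilon>
      by (auto intro!: extensionalityI[of _ "Obj A"] category.Comp_Idn_left[OF cat]
          simp: cat_functor.fobj_Obj nat_transD)
    subgoal for A B F F' \<epsilon>
      by (auto intro!: extensionalityI[of _ "Obj A"] category.Comp_Idn_right[OF cat]
          simp: cat_functor.fobj_Obj cat_functor.fmor_Idn nat_transD)
    done
qed

section \<open>Action groupoids\<close>

locale finite_action =
  fixes A :: "('x, 'g) gset"
  assumes finite_gset: "finite_gset A"
begin

sublocale group_action "grp A" "pts A" "act A"
  using finite_gset by (simp add: finite_gset_def)

sublocale group "grp A"
  by (rule group_hom.axioms(1)[OF group_hom])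

lemma act_mem [simp]: "\<lbrakk>g \<in> carrier (grp A); x \<in> pts A\<rbrakk> \<Longrightarrow> act A g x \<in> pts A"
  by (rule element_image) auto

lemma act_one [simp]: "x \<in> pts A \<Longrightarrow> act A \<one>\<^bsub>grp A\<^esub> x = x"
  using id_eq_one by (metis restrict_apply)

lemma act_mult: "\<lbrakk>x \<in> pts A; g \<in> carrier (grp A); h \<in> carrier (grp A)\<rbrakk>
    \<Longrightarrow> act A (g \<otimes>\<^bsub>grp A\<^esub> h) x = act A g (act A h x)"
  by (rule composition_rule)

lemma act_inv [simp]: "\<lbrakk>x \<in> pts A; g \<in> carrier (grp A)\<rbrakk>
    \<Longrightarrow> act A (inv\<^bsub>grp A\<^esub> g) (act A g x) = x"
  by (simp add: act_mult[symmetric])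

end

lemma action_groupoid_simps [simp]:
  "Obj (action_groupoid A) = pts A"
  "Hom (action_groupoid A) x x' = {g \<in> carrier (grp A). act A g x = x'}"
  "Idn (action_groupoid A) x = \<one>\<^bsub>grp A\<^esub>"
  "Comp (action_groupoid A) x y z h g = h \<otimes>\<^bsub>grp A\<^esub> g"
  by (simp_all add: action_groupoid_def)

lemma category_action_groupoid:
  assumes "finite_gset A"
  shows "category (action_groupoid A)"
proof -
  interpret A: finite_action A by unfold_locales fact
  show ?thesis
    by unfold_locales (auto simp: A.act_mult A.m_assoc)
qed

lemma is_iso_action_groupoid:
  assumes "finite_gset A" "x \<in> pts A" "g \<in> carrier (grp A)" "act A g x = y"
  shows "is_iso (action_groupoid A) x y g"
proof -
  interpret A: finite_action A by unfold_locales fact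
  show ?thesis
    using assms by (auto simp: is_iso_def intro!: exI[of _ "inv\<^bsub>grp A\<^esub> g"])
qed

lemma finite_groupoid_action_groupoid:
  assumes "finite_gset A"
  shows "finite_groupoid (action_groupoid A)"
  using assms category_action_groupoid[OF assms]
  by (auto simp: finite_groupoid_def is_iso_action_groupoid) (auto simp: finite_gset_def)

section \<open>Cells of \<open>S2\<close> as functors and natural transformations\<close>

lemma S_cells1D:
  assumes "f \<in> S_cells1 A B"
  shows "x \<in> pts A \<Longrightarrow> pmap f x \<in> pts B"
    and "\<lbrakk>x \<in> pts A; g \<in> carrier (grp A)\<rbrakk> \<Longrightarrow> gmap f x g \<in> carrier (grp B)"
    and "\<lbrakk>x \<in> pts A; g \<in> carrier (grp A)\<rbrakk> \<Longrightarrow> pmap f (act A g x) = act B (gmap f x g) (pmap f x)"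
    and "\<lbrakk>x \<in> pts A; g \<in> carrier (grp A); g' \<in> carrier (grp A)\<rbrakk>
      \<Longrightarrow> gmap f x (g \<otimes>\<^bsub>grp A\<^esub> g') = gmap f (act A g' x) g \<otimes>\<^bsub>grp B\<^esub> gmap f x g'"
  using assms by (auto simp: S_cells1_def PiE_iff)

text \<open>The cocycle identity at \<open>g = g' = 1\<close> makes this element idempotent, and the
  only idempotent of a group is its unit.\<close>

lemma S_cells1_one:
  assumes "finite_gset A" "finite_gset B" "f \<in> S_cells1 A B" "x \<in> pts A"
  shows "gmap f x \<one>\<^bsub>grp A\<^esub> = \<one>\<^bsub>grp B\<^esub>"
proof -
  interpret A: finite_action A by unfold_locales fact
  interpret B: finite_action B by unfold_locales fact
  have "gmap f x \<one>\<^bsub>grp A\<^esub> \<otimes>\<^bsub>grp B\<^esub> gmap f x \<one>\<^bsub>grp A\<^esub> = gmap f x \<one>\<^bsub>grp A\<^esub>"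
    using S_cells1D(4)[OF assms(3,4), of "\<one>\<^bsub>grp A\<^esub>" "\<one>\<^bsub>grp A\<^esub>"] assms(4) by simp
  then show ?thesis
    using S_cells1D(2)[OF assms(3,4)] by (simp add: B.l_cancel_one)
qed

lemma action_ftor_simps [simp]:
  "x \<in> pts A \<Longrightarrow> fobj (action_ftor A f) x = pmap f x"
  "\<lbrakk>x \<in> pts A; y \<in> pts A; g \<in> carrier (grp A); act A g x = y\<rbrakk>
    \<Longrightarrow> fmor (action_ftor A f) x y g = gmap f x g"
  by (auto simp: action_ftor_def)

lemma ext_functor_action_ftor: "ext_functor (action_groupoid A) (action_ftor A f)"
  by (auto simp: ext_functor_def action_ftor_def)

lemma cat_functor_action_ftor:
  assumes "finite_gset A" "finite_gset B" "f \<in> S_cells1 A B"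
  shows "cat_functor (action_groupoid A) (action_groupoid B) (action_ftor A f)"
proof -
  interpret A: finite_action A by unfold_locales fact
  interpret B: finite_action B by unfold_locales fact
  interpret cA: category "action_groupoid A" by (rule category_action_groupoid) fact
  interpret cB: category "action_groupoid B" by (rule category_action_groupoid) fact
  note [simp] = S_cells1D[OF assms(3)] S_cells1_one[OF assms]
  show ?thesis
    by unfold_locales (auto simp: A.act_mult)
qed

text \<open>The inverse of \<open>action_ftor A\<close> on 1-cells. A group element \<open>g\<close>
  is an arrow out of \<open>x\<close> for exactly one target, \<open>act A g x\<close>, which
  settles the second object index of \<open>fmor\<close>.\<close>

definition gmap_of_ftor :: "('x, 'g) gset \<Rightarrow> ('x, 'g, 'x, 'g) ftor \<Rightarrow> ('x, 'g) gmap" where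
  "gmap_of_ftor A F = \<lparr>
    pmap = (\<lambda>x\<in>pts A. fobj F x),
    gmap = (\<lambda>x\<in>pts A. \<lambda>g\<in>carrier (grp A). fmor F x (act A g x) g)\<rparr>"

lemma gmap_of_ftor_simps [simp]:
  "x \<in> pts A \<Longrightarrow> pmap (gmap_of_ftor A F) x = fobj F x"
  "\<lbrakk>x \<in> pts A; g \<in> carrier (grp A)\<rbrakk> \<Longrightarrow> gmap (gmap_of_ftor A F) x g = fmor F x (act A g x) g"
  by (auto simp: gmap_of_ftor_def)

text \<open>Equivariance says that \<open>F\<close> sends arrows to arrows with the right source and
  target; the cocycle identity is preservation of composition.\<close>

lemma gmap_of_ftor_S_cells1:
  assumes "finite_gset A" "cat_functor (action_groupoid A) (action_groupoid B) F"
  shows "gmap_of_ftor A F \<in> S_cells1 A B"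
proof -
  interpret A: finite_action A by unfold_locales fact
  interpret F: cat_functor "action_groupoid A" "action_groupoid B" F by fact
  have o: "fobj F x \<in> pts B" if "x \<in> pts A" for x
    using F.fobj_Obj that by simp
  have m: "fmor F x (act A g x) g \<in> carrier (grp B)"
    "act B (fmor F x (act A g x) g) (fobj F x) = fobj F (act A g x)"
    if "x \<in> pts A" "g \<in> carrier (grp A)" for x g
    using F.fmor_Hom[of x "act A g x" g] that by simp_all
  have c: "fmor F x (act A (g \<otimes>\<^bsub>grp A\<^esub> g') x) (g \<otimes>\<^bsub>grp A\<^esub> g') =
      fmor F (act A g' x) (act A g (act A g' x)) g \<otimes>\<^bsub>grp B\<^esub> fmor F x (act A g' x) g'"
    if "x \<in> pts A" "g \<in> carrier (grp A)" "g' \<in> carrier (grp A)" for x g g'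
    using F.fmor_Comp[of x "act A g' x" "act A g (act A g' x)" g' g] that
    by (simp add: A.act_mult)
  show ?thesis
    unfolding S_cells1_def mem_Collect_eq
    by (intro conjI ballI) (auto simp: gmap_of_ftor_def o m c)
qed

lemma action_ftor_gmap_of_ftor:
  assumes "ext_functor (action_groupoid A) F"
  shows "action_ftor A (gmap_of_ftor A F) = F"
  by (rule ftor_eqI[OF ext_functor_action_ftor assms]) auto

lemma gmap_eqI:
  assumes "f \<in> S_cells1 A B" "f' \<in> S_cells1 A B"
    and "\<And>x. x \<in> pts A \<Longrightarrow> pmap f x = pmap f' x"
    and "\<And>x g. \<lbrakk>x \<in> pts A; g \<in> carrier (grp A)\<rbrakk> \<Longrightarrow> gmap f x g = gmap f' x g"
  shows "f = f'"
proof -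
  have m: "pmap h \<in> pts A \<rightarrow>\<^sub>E pts B"
    "gmap h \<in> pts A \<rightarrow>\<^sub>E (carrier (grp A) \<rightarrow>\<^sub>E carrier (grp B))" if "h \<in> S_cells1 A B" for h
    using that by (simp_all add: S_cells1_def)
  have "pmap f = pmap f'"
    by (rule PiE_ext[OF m(1)[OF assms(1)] m(1)[OF assms(2)] assms(3)])
  moreover have "gmap f x = gmap f' x" if x: "x \<in> pts A" for x
    by (rule PiE_ext[OF PiE_mem[OF m(2)[OF assms(1)] x] PiE_mem[OF m(2)[OF assms(2)] x]])
      (rule assms(4)[OF x])
  then have "gmap f = gmap f'"
    by (rule PiE_ext[OF m(2)[OF assms(1)] m(2)[OF assms(2)]])
  ultimately show ?thesis by simp
qed

text \<open>By this injectivity, equations between 1-cells of \<open>S2\<close> can be checked on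
  their functors, where they are laws of \<open>finGpd\<close>.\<close>

lemma action_ftor_inject:
  assumes "finite_gset A" "f \<in> S_cells1 A B" "f' \<in> S_cells1 A B"
    and eq: "action_ftor A f = action_ftor A f'"
  shows "f = f'"
proof (rule gmap_eqI[OF assms(2,3)])
  interpret A: finite_action A by unfold_locales fact
  fix x assume x: "x \<in> pts A"
  show "pmap f x = pmap f' x"
    using arg_cong[OF eq, of "\<lambda>F. fobj F x"] x by simp
  fix g assume "g \<in> carrier (grp A)"
  then show "gmap f x g = gmap f' x g"
    using arg_cong[OF eq, of "\<lambda>F. fmor F x (act A g x) g"] x by simp
qed

text \<open>Multiplying the conjugation formula on the right by \<open>\<epsilon> x\<close> gives
  the naturality square of \<open>\<epsilon>\<close> at the arrow \<open>g\<close>. The condition on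
  points says that \<open>\<epsilon> x\<close> is an arrow between the images of
  \<open>x\<close>.\<close>

lemma S_cells2_eq:
  assumes "finite_gset A" "finite_gset B" "f \<in> S_cells1 A B" "f' \<in> S_cells1 A B"
  shows "S_cells2 A B f f' =
    Hom (functor_cat (action_groupoid A) (action_groupoid B)) (action_ftor A f) (action_ftor A f')"
proof -
  interpret A: finite_action A by unfold_locales fact
  interpret B: finite_action B by unfold_locales fact
  have *: "(\<epsilon> (act A g x) \<otimes>\<^bsub>grp B\<^esub> gmap f x g \<otimes>\<^bsub>grp B\<^esub> inv\<^bsub>grp B\<^esub> (\<epsilon> x) = gmap f' x g) \<longleftrightarrow>
     (\<epsilon> (act A g x) \<otimes>\<^bsub>grp B\<^esub> gmap f x g = gmap f' x g \<otimes>\<^bsub>grp B\<^esub> \<epsilon> x)"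
    if "\<forall>x\<in>pts A. \<epsilon> x \<in> carrier (grp B)" "x \<in> pts A" "g \<in> carrier (grp A)" for \<epsilon> x g
    using that B.inv_solve_right'[of "gmap f' x g" "\<epsilon> (act A g x) \<otimes>\<^bsub>grp B\<^esub> gmap f x g" "\<epsilon> x"]
      S_cells1D[OF assms(3)] S_cells1D[OF assms(4)] by simp
  have mem: "\<epsilon> \<in> S_cells2 A B f f' \<longleftrightarrow> \<epsilon> \<in> extensional (pts A) \<and>
      (\<forall>x\<in>pts A. \<epsilon> x \<in> carrier (grp B)) \<and> (\<forall>x\<in>pts A. pmap f' x = act B (\<epsilon> x) (pmap f x)) \<and>
      (\<forall>x\<in>pts A. \<forall>g\<in>carrier (grp A).
        \<epsilon> (act A g x) \<otimes>\<^bsub>grp B\<^esub> gmap f x g = gmap f' x g \<otimes>\<^bsub>grp B\<^esub> \<epsilon> x)" for \<epsilon>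
  proof -
    have "(\<forall>x\<in>pts A. \<forall>g\<in>carrier (grp A).
        \<epsilon> (act A g x) \<otimes>\<^bsub>grp B\<^esub> gmap f x g \<otimes>\<^bsub>grp B\<^esub> inv\<^bsub>grp B\<^esub> (\<epsilon> x) = gmap f' x g) \<longleftrightarrow>
      (\<forall>x\<in>pts A. \<forall>g\<in>carrier (grp A).
        \<epsilon> (act A g x) \<otimes>\<^bsub>grp B\<^esub> gmap f x g = gmap f' x g \<otimes>\<^bsub>grp B\<^esub> \<epsilon> x)"
      if "\<forall>x\<in>pts A. \<epsilon> x \<in> carrier (grp B)"
      by (intro ball_cong refl *[OF that])
    then show ?thesis
      unfolding S_cells2_def mem_Collect_eq PiE_iff by blast
  qed
  show ?thesis
    by (intro Set.set_eqI) (auto simp: mem nat_trans_def)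
qed

section \<open>Transfer of the 2-category laws to \<open>S2\<close>\<close>

lemma S_homc_simps [simp]:
  "Obj (S_homc A B) = S_cells1 A B"
  "Hom (S_homc A B) f f' = S_cells2 A B f f'"
  "Idn (S_homc A B) f = (\<lambda>x\<in>pts A. \<one>\<^bsub>grp B\<^esub>)"
  "Comp (S_homc A B) f f' f'' \<epsilon>' \<epsilon> = (\<lambda>x\<in>pts A. \<epsilon>' x \<otimes>\<^bsub>grp B\<^esub> \<epsilon> x)"
  by (simp_all add: S_homc_def S_vcomp_def)

lemma S2_simps [simp]:
  "Cells0 S2 = {A. finite_gset A}"
  "Homc S2 = S_homc"
  "Id1 S2 = S_id1"
  "comp1 S2 A B C k f = S_comp1 A k f"
  "comp2 S2 A B C k k' f f' \<rho> \<epsilon> =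
    (\<lambda>x\<in>pts A. \<rho> (pmap f' x) \<otimes>\<^bsub>grp C\<^esub> gmap k (pmap f x) (\<epsilon> x))"
  by (auto simp: S2_def S_vcomp_def S_whisker_left_def S_whisker_right_def cong: restrict_cong)

lemma E2_simps [simp]:
  "map0 E2 = action_groupoid"
  "fobj (mapc E2 A B) = action_ftor A"
  "fmor (mapc E2 A B) f f' \<epsilon> = restrict \<epsilon> (pts A)"
  by (simp_all add: E2_def)

lemma S_id1_S_cells1:
  assumes "finite_gset A" shows "S_id1 A \<in> S_cells1 A A"
proof -
  interpret A: finite_action A by unfold_locales fact
  show ?thesis by (auto simp: S_cells1_def S_id1_def)
qed

lemma action_ftor_S_id1:
  shows "action_ftor A (S_id1 A) = id_ftor (action_groupoid A)"
  by (rule ftor_eqI[OF ext_functor_action_ftor ext_functor_id_ftor]) (auto simp: S_id1_def)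

lemma S_comp1_S_cells1:
  assumes "finite_gset A" "f \<in> S_cells1 A B" "k \<in> S_cells1 B C"
  shows "S_comp1 A k f \<in> S_cells1 A C"
proof -
  interpret A: finite_action A by unfold_locales fact
  show ?thesis
    using S_cells1D[OF assms(2)] S_cells1D[OF assms(3)]
    by (auto simp: S_cells1_def S_comp1_def)
qed

lemma action_ftor_S_comp1:
  assumes "finite_gset B" "f \<in> S_cells1 A B"
  shows "action_ftor A (S_comp1 A k f) = comp_ftor (action_groupoid A) (action_ftor B k) (action_ftor A f)"
proof -
  interpret B: finite_action B by unfold_locales fact
  show ?thesis
    by (rule ftor_eqI[OF ext_functor_action_ftor ext_functor_comp_ftor])
      (use S_cells1D[OF assms(2)] in \<open>auto simp: S_comp1_def\<close>)
qed

text \<open>Since \<open>\<epsilon>\<close> is a 2-cell, \<open>\<epsilon> x\<close> is an arrow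
  from \<open>pmap f x\<close> to \<open>pmap f' x\<close>. Hence \<open>action_ftor B k\<close> is
  evaluated inside its domain, where it agrees with \<open>gmap k (pmap f x)\<close>.\<close>

lemma S2_comp2_eq_hcomp_trans:
  assumes "finite_gset A" "finite_gset B" "finite_gset C"
    and "f \<in> S_cells1 A B" "f' \<in> S_cells1 A B"
    and "\<epsilon> \<in> S_cells2 A B f f'"
  shows "comp2 S2 A B C k k' f f' \<rho> \<epsilon> = hcomp_trans (action_groupoid A) (action_groupoid C)
      (action_ftor B k) (action_ftor B k') (action_ftor A f) (action_ftor A f') \<rho> \<epsilon>"
  using assms(6) S_cells1D[OF assms(4)] S_cells1D[OF assms(5)]
  by (intro extensionalityI[of _ "pts A"])
    (auto simp: S_cells2_def PiE_iff hcomp_trans_def)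

text \<open>Along \<open>action_ftor\<close> the hom-sets, identities and composites are literally
  those of the functor category \<open>?F\<close>, so each law is an instance of the one in
  \<open>?F\<close>. The unfolding rules are removed to keep the terms in the form in which these
  instances apply.\<close>

lemma category_S_homc:
  assumes "finite_gset A" "finite_gset B"
  shows "category (S_homc A B)"
proof -
  let ?F = "functor_cat (action_groupoid A) (action_groupoid B)"
  interpret F: category ?F
    by (intro category_functor_cat category_action_groupoid assms)
  have o [simp]: "action_ftor A f \<in> Obj ?F" if "f \<in> S_cells1 A B" for f
    using that by (simp add: cat_functor_action_ftor ext_functor_action_ftor assms)
  have I: "Idn (S_homc A B) f = Idn ?F (action_ftor A f)" for f by simp
  have c: "Comp (S_homc A B) f f' f'' = Comp ?F (action_ftor A f) (action_ftor A f') (action_ftor A f'')"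
    for f f' f'' by (intro ext) simp
  note [simp del] = functor_cat_simps S_homc_simps(3,4)
  show ?thesis
    apply (rule category.intro)
    subgoal by (simp add: I S_cells2_eq assms F.Idn_Hom)
    subgoal for f f' f'' unfolding c by (simp add: S_cells2_eq assms F.Comp_Hom[of _ "action_ftor A f'"])
    subgoal by (simp add: I c S_cells2_eq assms F.Comp_Idn_left)
    subgoal by (simp add: I c S_cells2_eq assms F.Comp_Idn_right)
    subgoal by (simp add: c S_cells2_eq assms F.Comp_assoc)
    done
qed

lemma cat_functor_mapc_E2:
  assumes "finite_gset A" "finite_gset B"
  shows "cat_functor (S_homc A B) (functor_cat (action_groupoid A) (action_groupoid B)) (mapc E2 A B)"
proof -
  interpret S: category "S_homc A B" by (rule category_S_homc[OF assms])
  interpret F: category "functor_cat (action_groupoid A) (action_groupoid B)"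
    by (intro category_functor_cat category_action_groupoid assms)
  show ?thesis
    apply unfold_locales
    subgoal using assms by (simp add: cat_functor_action_ftor ext_functor_action_ftor)
    subgoal using assms by (auto simp: S_cells2_eq extensional_restrict)
    subgoal by auto
    subgoal by (auto intro!: restrict_ext)
    done
qed

lemma S2_comp2_S_cells2:
  assumes AB: "finite_gset A" "finite_gset B" "finite_gset C"
    and f: "f \<in> S_cells1 A B" "f' \<in> S_cells1 A B" "\<epsilon> \<in> S_cells2 A B f f'"
    and k: "k \<in> S_cells1 B C" "k' \<in> S_cells1 B C" "\<rho> \<in> S_cells2 B C k k'"
  shows "comp2 S2 A B C k k' f f' \<rho> \<epsilon> \<in> S_cells2 A C (S_comp1 A k f) (S_comp1 A k' f')"
proof -
  have "nat_trans (action_groupoid A) (action_groupoid C)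
      (comp_ftor (action_groupoid A) (action_ftor B k) (action_ftor A f))
      (comp_ftor (action_groupoid A) (action_ftor B k') (action_ftor A f'))
    (hcomp_trans (action_groupoid A) (action_groupoid C)
      (action_ftor B k) (action_ftor B k') (action_ftor A f) (action_ftor A f') \<rho> \<epsilon>)"
    using assms by (intro nat_trans_hcomp) (auto simp: S_cells2_eq cat_functor_action_ftor)
  then show ?thesis
    unfolding S2_comp2_eq_hcomp_trans[OF AB f]
    using assms hcomp_trans_ext[of "action_groupoid A"]
    by (simp add: S_cells2_eq S_comp1_S_cells1[of A f B] action_ftor_S_comp1[of B f A]
        action_ftor_S_comp1[of B f' A] S_comp1_S_cells1[of A f' B])
qed

lemma two_category_S2: "two_category S2"
proof -
  note fg [simp] = cat_functor_action_ftor ext_functor_action_ftor finite_groupoid_action_groupoid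
    S_id1_S_cells1 S_comp1_S_cells1 category_S_homc
  interpret T: two_category finGpd by (rule two_category_finGpd)
  show ?thesis
  proof (rule two_category.intro)
    fix A B C :: "('x, 'y) gset"
    assume "A \<in> Cells0 S2" "B \<in> Cells0 S2" "C \<in> Cells0 S2"
    then have [simp]: "finite_gset A" "finite_gset B" "finite_gset C" by simp_all
    interpret F: cat_functor "prod_cat (functor_cat (action_groupoid B) (action_groupoid C))
        (functor_cat (action_groupoid A) (action_groupoid B))"
      "functor_cat (action_groupoid A) (action_groupoid C)"
      "Hcomp finGpd (action_groupoid A) (action_groupoid B) (action_groupoid C)"
      by (intro cat_functor_Hcomp_finGpd category_action_groupoid) auto
    show "cat_functor (prod_cat (Homc S2 B C) (Homc S2 A B)) (Homc S2 A C) (Hcomp S2 A B C)"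
    proof (intro cat_functor.intro cat_functor_axioms.intro)
      show "category (prod_cat (Homc S2 B C) (Homc S2 A B))" "category (Homc S2 A C)"
        by (auto intro!: category_prod_cat)
    next
      fix p assume "p \<in> Obj (prod_cat (Homc S2 B C) (Homc S2 A B))"
      then obtain k f where p: "p = (k, f)" "k \<in> S_cells1 B C" "f \<in> S_cells1 A B" by auto
      show "fobj (Hcomp S2 A B C) p \<in> Obj (Homc S2 A C)"
        using p by simp
      show "fmor (Hcomp S2 A B C) p p (Idn (prod_cat (Homc S2 B C) (Homc S2 A B)) p) =
        Idn (Homc S2 A C) (fobj (Hcomp S2 A B C) p)"
      proof -
        \<comment> \<open>The translation of \<open>comp2\<close> into \<open>hcomp_trans\<close>
          applies only when its last argument is known to be a 2-cell, here the identity.\<close>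
        have "Idn (S_homc A B) f \<in> S_cells2 A B f f"
          using category.Idn_Hom[OF category_S_homc[of A B], of f] p by simp
        then show ?thesis
          using F.fmor_Idn[of "(action_ftor B k, action_ftor A f)"] p
          by (simp add: S2_comp2_eq_hcomp_trans del: S2_simps(5))
      qed
    next
      fix p q s
      assume "p \<in> Obj (prod_cat (Homc S2 B C) (Homc S2 A B))"
         "q \<in> Obj (prod_cat (Homc S2 B C) (Homc S2 A B))"
      then obtain k f k' f' where p: "p = (k, f)" "k \<in> S_cells1 B C" "f \<in> S_cells1 A B"
        and q: "q = (k', f')" "k' \<in> S_cells1 B C" "f' \<in> S_cells1 A B" by auto
      assume "s \<in> Hom (prod_cat (Homc S2 B C) (Homc S2 A B)) p q"
      then obtain \<rho> \<epsilon> where s: "s = (\<rho>, \<epsilon>)" "\<rho> \<in> S_cells2 B C k k'" "\<epsilon> \<in> S_cells2 A B f f'"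
        using p q by auto
      show "fmor (Hcomp S2 A B C) p q s \<in>
          Hom (Homc S2 A C) (fobj (Hcomp S2 A B C) p) (fobj (Hcomp S2 A B C) q)"
        using p q s S2_comp2_S_cells2[of A B C] by (simp del: S2_simps(5))
      fix r t
      assume "r \<in> Obj (prod_cat (Homc S2 B C) (Homc S2 A B))"
      then obtain k'' f'' where r: "r = (k'', f'')" "k'' \<in> S_cells1 B C" "f'' \<in> S_cells1 A B" by auto
      assume "t \<in> Hom (prod_cat (Homc S2 B C) (Homc S2 A B)) q r"
      then obtain \<rho>' \<epsilon>' where t: "t = (\<rho>', \<epsilon>')" "\<rho>' \<in> S_cells2 B C k' k''" "\<epsilon>' \<in> S_cells2 A B f' f''"
        using q r by auto
      \<comment> \<open>Again the side condition for the translation, now for the vertical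
        composite.\<close>
      have "Comp (S_homc A B) f f' f'' \<epsilon>' \<epsilon> \<in> S_cells2 A B f f''"
        using category.Comp_Hom[OF category_S_homc[of A B], of f f' f'' \<epsilon> \<epsilon>'] p q r s t by simp
      then have "comp2 S2 A B C k k'' f f'' (Comp (S_homc B C) k k' k'' \<rho>' \<rho>)
          (Comp (S_homc A B) f f' f'' \<epsilon>' \<epsilon>) =
         Comp (S_homc A C) (S_comp1 A k f) (S_comp1 A k' f') (S_comp1 A k'' f'')
          (comp2 S2 A B C k' k'' f' f'' \<rho>' \<epsilon>') (comp2 S2 A B C k k' f f' \<rho> \<epsilon>)"
        using F.fmor_Comp[of "(action_ftor B k, action_ftor A f)" "(action_ftor B k', action_ftor A f')"
            "(action_ftor B k'', action_ftor A f'')" s t] p q r s t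
        by (simp add: S2_comp2_eq_hcomp_trans del: S2_simps(5) hcomp_trans_apply) (simp add: S_cells2_eq)
      then show "fmor (Hcomp S2 A B C) p r (Comp (prod_cat (Homc S2 B C) (Homc S2 A B)) p q r t s) =
        Comp (Homc S2 A C) (fobj (Hcomp S2 A B C) p) (fobj (Hcomp S2 A B C) q) (fobj (Hcomp S2 A B C) r)
          (fmor (Hcomp S2 A B C) q r t) (fmor (Hcomp S2 A B C) p q s)"
        by (simp add: p q r s t)
    qed
  next
    fix A B C D :: "('x, 'y) gset"
    fix f g h
    assume "A \<in> Cells0 S2" "B \<in> Cells0 S2" "C \<in> Cells0 S2" "D \<in> Cells0 S2"
      "f \<in> Obj (Homc S2 A B)" "g \<in> Obj (Homc S2 B C)" "h \<in> Obj (Homc S2 C D)"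
    then have [simp]: "finite_gset A" "finite_gset B" "finite_gset C" "finite_gset D"
       "f \<in> S_cells1 A B" "g \<in> S_cells1 B C" "h \<in> S_cells1 C D"
      by simp_all
    have [simp]: "S_comp1 A g f \<in> S_cells1 A C"
      by (simp add: S_comp1_S_cells1[of A _ B])
    \<comment> \<open>Associativity is proved for the functors and pulled back along the injective
      \<open>action_ftor A\<close>.\<close>
    have "action_ftor A (S_comp1 A (S_comp1 B h g) f) = action_ftor A (S_comp1 A h (S_comp1 A g f))"
      by (simp add: action_ftor_S_comp1[of B f A] action_ftor_S_comp1[of C _ A]
          action_ftor_S_comp1[of C _ B] comp_ftor_assoc[OF cat_functor_action_ftor])
    then show "comp1 S2 A B D (comp1 S2 B C D h g) f = comp1 S2 A C D h (comp1 S2 A B C g f)"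
      unfolding S2_simps
      by (rule action_ftor_inject[of A _ D, rotated 3])
        (simp_all add: S_comp1_S_cells1[of A _ B _ D] S_comp1_S_cells1[of A _ C _ D]
          S_comp1_S_cells1[of B _ C _ D])
  next
    fix A B C D :: "('x, 'y) gset"
    fix f f' g g' h h' \<epsilon> \<rho> \<sigma>
    assume "A \<in> Cells0 S2" "B \<in> Cells0 S2" "C \<in> Cells0 S2" "D \<in> Cells0 S2"
      and "f \<in> Obj (Homc S2 A B)" "f' \<in> Obj (Homc S2 A B)" "\<epsilon> \<in> Hom (Homc S2 A B) f f'"
        "g \<in> Obj (Homc S2 B C)" "g' \<in> Obj (Homc S2 B C)" "\<rho> \<in> Hom (Homc S2 B C) g g'"
        "h \<in> Obj (Homc S2 C D)" "h' \<in> Obj (Homc S2 C D)" "\<sigma> \<in> Hom (Homc S2 C D) h h'"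
    then have mem [simp]: "finite_gset A" "finite_gset B" "finite_gset C" "finite_gset D"
       "f \<in> S_cells1 A B" "f' \<in> S_cells1 A B" "\<epsilon> \<in> S_cells2 A B f f'"
        "g \<in> S_cells1 B C" "g' \<in> S_cells1 B C" "\<rho> \<in> S_cells2 B C g g'"
        "h \<in> S_cells1 C D" "h' \<in> S_cells1 C D" "\<sigma> \<in> S_cells2 C D h h'"
      by simp_all
    have "comp2 S2 A B C g g' f f' \<rho> \<epsilon> \<in> S_cells2 A C (S_comp1 A g f) (S_comp1 A g' f')"
      by (rule S2_comp2_S_cells2) simp_all
    then have [simp]: "hcomp_trans (action_groupoid A) (action_groupoid C) (action_ftor B g)
        (action_ftor B g') (action_ftor A f) (action_ftor A f') \<rho> \<epsilon>
      \<in> S_cells2 A C (S_comp1 A g f) (S_comp1 A g' f')"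
      by (simp add: S2_comp2_eq_hcomp_trans del: S2_simps(5))
    have [simp]: "S_comp1 A g f \<in> S_cells1 A C" "S_comp1 A g' f' \<in> S_cells1 A C"
      by (simp_all add: S_comp1_S_cells1[of A _ B])
    have "hcomp_trans (action_groupoid A) (action_groupoid D)
      (comp_ftor (action_groupoid B) (action_ftor C h) (action_ftor B g))
      (comp_ftor (action_groupoid B) (action_ftor C h') (action_ftor B g'))
      (action_ftor A f) (action_ftor A f')
      (hcomp_trans (action_groupoid B) (action_groupoid D) (action_ftor C h) (action_ftor C h')
        (action_ftor B g) (action_ftor B g') \<sigma> \<rho>) \<epsilon> =
    hcomp_trans (action_groupoid A) (action_groupoid D) (action_ftor C h) (action_ftor C h')
      (comp_ftor (action_groupoid A) (action_ftor B g) (action_ftor A f))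
      (comp_ftor (action_groupoid A) (action_ftor B g') (action_ftor A f')) \<sigma>
      (hcomp_trans (action_groupoid A) (action_groupoid C) (action_ftor B g) (action_ftor B g')
        (action_ftor A f) (action_ftor A f') \<rho> \<epsilon>)"
      using mem by (intro hcomp_trans_assoc cat_functor_action_ftor) (auto simp: S_cells2_eq)
    then show "comp2 S2 A B D (comp1 S2 B C D h g) (comp1 S2 B C D h' g') f f'
            (comp2 S2 B C D h h' g g' \<sigma> \<rho>) \<epsilon> =
          comp2 S2 A C D h h' (comp1 S2 A B C g f) (comp1 S2 A B C g' f')
            \<sigma> (comp2 S2 A B C g g' f f' \<rho> \<epsilon>)"
      by (simp add: S2_comp2_eq_hcomp_trans action_ftor_S_comp1[of B f A] action_ftor_S_comp1[of B f' A]
          action_ftor_S_comp1[of C g B] action_ftor_S_comp1[of C g' B] del: S2_simps(5))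
  next
    fix A B :: "('x, 'y) gset" and f
    assume A: "A \<in> Cells0 S2" "B \<in> Cells0 S2" and "f \<in> Obj (Homc S2 A B)"
    then have f: "f \<in> S_cells1 A B" by simp
    have "action_ftor A (S_comp1 A (S_id1 B) f) = action_ftor A f"
      using A f by (simp add: action_ftor_S_comp1[of B f A] action_ftor_S_id1
          comp_ftor_id_left[of _ "action_groupoid B"])
    then show "comp1 S2 A B B (Id1 S2 B) f = f"
      unfolding S2_simps using A f
      by (intro action_ftor_inject[of A _ B]) (simp_all add: S_comp1_S_cells1[of A _ B])
    have "action_ftor A (S_comp1 A f (S_id1 A)) = action_ftor A f"
      using A f by (simp add: action_ftor_S_comp1[of A _ A] action_ftor_S_id1 comp_ftor_id_right)
    then show "comp1 S2 A A B f (Id1 S2 A) = f"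
      unfolding S2_simps using A f
      by (intro action_ftor_inject[of A _ B]) (simp_all add: S_comp1_S_cells1[of A _ A])
    fix f' \<epsilon>
    assume "f' \<in> Obj (Homc S2 A B)" and "\<epsilon> \<in> Hom (Homc S2 A B) f f'"
    then have f': "f' \<in> S_cells1 A B" and \<epsilon>: "\<epsilon> \<in> S_cells2 A B f f'" by simp_all
    interpret A: finite_action A using A by unfold_locales simp
    interpret B: finite_action B using A by unfold_locales simp
    have e: "\<epsilon> \<in> extensional (pts A)" "\<And>x. x \<in> pts A \<Longrightarrow> \<epsilon> x \<in> carrier (grp B)"
      using \<epsilon> by (auto simp: S_cells2_def PiE_iff)
    show "comp2 S2 A B B (Id1 S2 B) (Id1 S2 B) f f' (Id2 S2 B B (Id1 S2 B)) \<epsilon> = \<epsilon>"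
      by (rule extensionalityI[OF _ e(1)])
        (simp_all add: S_id1_def e S_cells1D[OF f] S_cells1D[OF f'])
    \<comment> \<open>At \<open>x\<close> the composite is \<open>\<epsilon> x\<close> times
      \<open>gmap f x\<close> of the unit, and the latter factor is trivial by
      \<open>S_cells1_one\<close>.\<close>
    show "comp2 S2 A A B f f' (Id1 S2 A) (Id1 S2 A) \<epsilon> (Id2 S2 A A (Id1 S2 A)) = \<epsilon>"
      using A by (intro extensionalityI[OF _ e(1)])
        (simp_all add: S_id1_def e S_cells1_one[OF _ _ f])
  qed simp_all
qed

lemma strict_two_functor_E2: "strict_two_functor S2 finGpd E2"
proof (intro strict_two_functor.intro strict_two_functor_axioms.intro
    two_category_S2 two_category_finGpd)
  fix A B C :: "('x, 'y) gset"
  assume A: "A \<in> Cells0 S2" 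
  then show "map0 E2 A \<in> Cells0 finGpd"
    by (simp add: finite_groupoid_action_groupoid)
  show "fobj (mapc E2 A A) (Id1 S2 A) = Id1 finGpd (map0 E2 A)"
    by (simp add: action_ftor_S_id1)
  assume B: "B \<in> Cells0 S2"
  then show "cat_functor (Homc S2 A B) (Homc finGpd (map0 E2 A) (map0 E2 B)) (mapc E2 A B)"
    using A cat_functor_mapc_E2 by simp
  fix f f' \<epsilon> k k' \<rho>
  assume C: "C \<in> Cells0 S2"
    and f: "f \<in> Obj (Homc S2 A B)" and k: "k \<in> Obj (Homc S2 B C)"
  then show "fobj (mapc E2 A C) (comp1 S2 A B C k f) =
      comp1 finGpd (map0 E2 A) (map0 E2 B) (map0 E2 C) (fobj (mapc E2 B C) k) (fobj (mapc E2 A B) f)"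
    using B by (simp add: action_ftor_S_comp1[of B])
  assume f': "f' \<in> Obj (Homc S2 A B)" "\<epsilon> \<in> Hom (Homc S2 A B) f f'"
    and k': "k' \<in> Obj (Homc S2 B C)" "\<rho> \<in> Hom (Homc S2 B C) k k'"
  \<comment> \<open>2-cells are extensional, so the restriction built into \<open>E2\<close> leaves
    them unchanged.\<close>
  have r: "restrict \<epsilon> (pts A) = \<epsilon>" "restrict \<rho> (pts B) = \<rho>"
    using f' k' by (auto simp: S_cells2_def PiE_restrict)
  have "restrict (comp2 S2 A B C k k' f f' \<rho> \<epsilon>) (pts A) = comp2 S2 A B C k k' f f' \<rho> \<epsilon>"
    by simp
  also have "\<dots> = hcomp_trans (action_groupoid A) (action_groupoid C)
      (action_ftor B k) (action_ftor B k') (action_ftor A f) (action_ftor A f') \<rho> \<epsilon>"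
    using A B C f f' by (intro S2_comp2_eq_hcomp_trans) simp_all
  finally show "fmor (mapc E2 A C) (comp1 S2 A B C k f) (comp1 S2 A B C k' f')
        (comp2 S2 A B C k k' f f' \<rho> \<epsilon>) =
      comp2 finGpd (map0 E2 A) (map0 E2 B) (map0 E2 C)
        (fobj (mapc E2 B C) k) (fobj (mapc E2 B C) k') (fobj (mapc E2 A B) f) (fobj (mapc E2 A B) f')
        (fmor (mapc E2 B C) k k' \<rho>) (fmor (mapc E2 A B) f f' \<epsilon>)"
    by (simp only: E2_simps finGpd_simps r)
qed

section \<open>Equivalences\<close>

lemma is_isoE:
  assumes "is_iso C x y f"
  obtains g where "f \<in> Hom C x y" "g \<in> Hom C y x" "Comp C x y x g f = Idn C x"
    "Comp C y x y f g = Idn C y"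
  using assms by (auto simp: is_iso_def)

text \<open>Pointwise inverses are natural: insert \<open>\<eta> x\<close> after
  \<open>\<eta>' x\<close> in front of the image of \<open>f\<close>, slide that image through the
  naturality square of \<open>\<eta>\<close>, and cancel at \<open>y\<close>.\<close>

lemma nat_iso_inverse:
  assumes "cat_functor C D F" "cat_functor C D F'" and n: "nat_iso C D F F' \<eta>"
  obtains \<eta>' where "nat_iso C D F' F \<eta>'"
    "\<And>x. x \<in> Obj C \<Longrightarrow> Comp D (fobj F x) (fobj F' x) (fobj F x) (\<eta>' x) (\<eta> x) = Idn D (fobj F x)"
    "\<And>x. x \<in> Obj C \<Longrightarrow> Comp D (fobj F' x) (fobj F x) (fobj F' x) (\<eta> x) (\<eta>' x) = Idn D (fobj F' x)"
proof -
  interpret F: cat_functor C D F by fact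
  interpret F': cat_functor C D F' by fact
  have nt: "nat_trans C D F F' \<eta>" using n by (simp add: nat_iso_def)
  have "\<forall>x\<in>Obj C. \<exists>g. g \<in> Hom D (fobj F' x) (fobj F x) \<and>
      Comp D (fobj F x) (fobj F' x) (fobj F x) g (\<eta> x) = Idn D (fobj F x) \<and>
      Comp D (fobj F' x) (fobj F x) (fobj F' x) (\<eta> x) g = Idn D (fobj F' x)"
    using n by (auto simp: nat_iso_def is_iso_def)
  then obtain \<eta>' where \<eta>' [simp]: "\<And>x. x \<in> Obj C \<Longrightarrow> \<eta>' x \<in> Hom D (fobj F' x) (fobj F x)"
    "\<And>x. x \<in> Obj C \<Longrightarrow> Comp D (fobj F x) (fobj F' x) (fobj F x) (\<eta>' x) (\<eta> x) = Idn D (fobj F x)"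
    "\<And>x. x \<in> Obj C \<Longrightarrow> Comp D (fobj F' x) (fobj F x) (fobj F' x) (\<eta> x) (\<eta>' x) = Idn D (fobj F' x)"
    unfolding bchoice_iff by blast
  note [simp] = F.fobj_Obj F'.fobj_Obj F.fmor_Hom F'.fmor_Hom F.D.Comp_Hom nat_transD[OF nt]
  have "Comp D (fobj F' x) (fobj F' y) (fobj F y) (\<eta>' y) (fmor F' x y f) =
      Comp D (fobj F' x) (fobj F x) (fobj F y) (fmor F x y f) (\<eta>' x)"
    if [simp]: "x \<in> Obj C" "y \<in> Obj C" "f \<in> Hom C x y" for x y f
  proof -
    let ?c = "Comp D" and ?a = "fobj F x" and ?b = "fobj F y" and ?a' = "fobj F' x" and ?b' = "fobj F' y"
    have "?c ?a' ?b' ?b (\<eta>' y) (fmor F' x y f) =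
        ?c ?a' ?b' ?b (\<eta>' y) (?c ?a' ?a' ?b' (fmor F' x y f) (?c ?a' ?a ?a' (\<eta> x) (\<eta>' x)))"
      by (simp add: F.D.Comp_Idn_right)
    also have "\<dots> = ?c ?a' ?b' ?b (\<eta>' y) (?c ?a' ?a ?b' (?c ?a ?a' ?b' (fmor F' x y f) (\<eta> x)) (\<eta>' x))"
      by (subst F.D.Comp_assoc) (simp_all del: \<eta>'(2,3))
    also have "\<dots> = ?c ?a' ?b' ?b (\<eta>' y) (?c ?a' ?a ?b' (?c ?a ?b ?b' (\<eta> y) (fmor F x y f)) (\<eta>' x))"
      by (simp add: nat_trans_natural[OF nt])
    also have "\<dots> = ?c ?a' ?b' ?b (\<eta>' y) (?c ?a' ?b ?b' (\<eta> y) (?c ?a' ?a ?b (fmor F x y f) (\<eta>' x)))"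
      by (simp add: F.D.Comp_assoc)
    also have "\<dots> = ?c ?a' ?b ?b (?c ?b ?b' ?b (\<eta>' y) (\<eta> y)) (?c ?a' ?a ?b (fmor F x y f) (\<eta>' x))"
      by (rule F.D.Comp_assoc[symmetric]) simp_all
    finally show ?thesis
      by (simp add: F.D.Comp_Idn_left)
  qed
  moreover have "is_iso D (fobj F' x) (fobj F x) (\<eta>' x)" if "x \<in> Obj C" for x
    using that unfolding is_iso_def by (intro conjI bexI[of _ "\<eta> x"]) simp_all
  ultimately have "nat_iso C D F' F \<eta>'"
    by (auto simp: nat_iso_def nat_trans_def)
  then show thesis using that \<eta>' by blast
qed

text \<open>The two functors exchange roles. Unit and counit then point the wrong way and are
  replaced by their inverses.\<close>

lemma equivalence_of_categories_sym:
  assumes "equivalence_of_categories C D F"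
  shows "\<exists>G. equivalence_of_categories D C G"
proof -
  from assms obtain G \<eta> \<epsilon> where F: "cat_functor C D F" and G: "cat_functor D C G"
    and \<eta>: "nat_iso C C (id_ftor C) (comp_ftor C G F) \<eta>"
    and \<epsilon>: "nat_iso D D (comp_ftor D F G) (id_ftor D) \<epsilon>"
    by (auto simp: equivalence_of_categories_def)
  have "cat_functor C C (id_ftor C)" "cat_functor D D (id_ftor D)"
    using cat_functor_id_ftor[OF cat_functor.axioms(1)[OF F]]
      cat_functor_id_ftor[OF cat_functor.axioms(2)[OF F]] .
  then obtain \<eta>' \<epsilon>' where "nat_iso C C (comp_ftor C G F) (id_ftor C) \<eta>'"
    "nat_iso D D (id_ftor D) (comp_ftor D F G) \<epsilon>'"
    using \<eta> \<epsilon> F G by (metis nat_iso_inverse cat_functor_comp_ftor)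
  then show ?thesis
    using F G by (auto simp: equivalence_of_categories_def)
qed

lemma is_iso_functor_cat:
  assumes F: "cat_functor C D F" "cat_functor C D F'" and n: "nat_iso C D F F' \<eta>"
  shows "is_iso (functor_cat C D) F F' (restrict \<eta> (Obj C))"
proof -
  obtain \<eta>' where \<eta>': "nat_iso C D F' F \<eta>'"
    "\<And>x. x \<in> Obj C \<Longrightarrow> Comp D (fobj F x) (fobj F' x) (fobj F x) (\<eta>' x) (\<eta> x) = Idn D (fobj F x)"
    "\<And>x. x \<in> Obj C \<Longrightarrow> Comp D (fobj F' x) (fobj F x) (fobj F' x) (\<eta> x) (\<eta>' x) = Idn D (fobj F' x)"
    using nat_iso_inverse[OF F n] by blast
  have "nat_trans C D F F' (restrict \<eta> (Obj C))" "nat_trans C D F' F (restrict \<eta>' (Obj C))"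
    using n \<eta>'(1) by (auto simp: nat_iso_def nat_trans_def)
  then show ?thesis
    by (auto simp: is_iso_def \<eta>' intro!: bexI[of _ "restrict \<eta>' (Obj C)"] restrict_ext)
qed

lemma equivalent_cells0_finGpdI:
  fixes C D :: "('x, 'g) cat"
  assumes "equivalence_of_categories C D F"
  shows "equivalent_cells0 finGpd C D"
proof -
  from assms obtain G \<eta> \<epsilon> where F: "cat_functor C D F" and G: "cat_functor D C G"
    and \<eta>: "nat_iso C C (id_ftor C) (comp_ftor C G F) \<eta>"
    and \<epsilon>: "nat_iso D D (comp_ftor D F G) (id_ftor D) \<epsilon>"
    by (auto simp: equivalence_of_categories_def)
  interpret F: cat_functor C D F by fact
  interpret G: cat_functor D C G by fact
  \<comment> \<open>Composing with an identity functor makes \<open>F\<close> and \<open>G\<close> extensional.\<close>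
  define F' where "F' = comp_ftor C F (id_ftor C)"
  define G' where "G' = comp_ftor D G (id_ftor D)"
  have i: "cat_functor C C (id_ftor C)" "cat_functor D D (id_ftor D)"
    using cat_functor_id_ftor[OF cat_functor.axioms(1)[OF F]]
      cat_functor_id_ftor[OF cat_functor.axioms(2)[OF F]] .
  have F': "cat_functor C D F'" "ext_functor C F'" and G': "cat_functor D C G'" "ext_functor D G'"
    unfolding F'_def G'_def using F G i
    by (auto intro: cat_functor_comp_ftor ext_functor_comp_ftor)
  have GF: "comp_ftor C G' F' = comp_ftor C G F" and FG: "comp_ftor D F' G' = comp_ftor D F G"
    by (rule ftor_eqI[OF ext_functor_comp_ftor ext_functor_comp_ftor];
        simp add: F'_def G'_def F.fobj_Obj F.fmor_Hom G.fobj_Obj G.fmor_Hom)+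
  have "is_iso (functor_cat C C) (id_ftor C) (comp_ftor C G F) (restrict \<eta> (Obj C))"
    "is_iso (functor_cat D D) (comp_ftor D F G) (id_ftor D) (restrict \<epsilon> (Obj D))"
    using \<eta> \<epsilon> F G i by (auto intro!: is_iso_functor_cat intro: cat_functor_comp_ftor)
  then show ?thesis
    unfolding equivalent_cells0_def using F' G'
    by (intro bexI[of _ F'] bexI[of _ G'] conjI exI) (simp_all add: GF FG)
qed

text \<open>Fully faithful and essentially surjective functors. No quasi-inverse has to be
  exhibited, which makes this the convenient form for constructing and composing
  equivalences.\<close>

definition weak_equivalence ::
    "('o, 'm) cat \<Rightarrow> ('p, 'n) cat \<Rightarrow> ('o, 'm, 'p, 'n) ftor \<Rightarrow> bool" where
  "weak_equivalence C D P \<longleftrightarrow> cat_functor C D P \<and>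
    (\<forall>x\<in>Obj C. \<forall>y\<in>Obj C. bij_betw (fmor P x y) (Hom C x y) (Hom D (fobj P x) (fobj P y))) \<and>
    (\<forall>d\<in>Obj D. \<exists>c\<in>Obj C. \<exists>h. is_iso D (fobj P c) d h)"

lemma weak_equivalence_comp_ftor:
  assumes P: "weak_equivalence C D P" and Q: "weak_equivalence D E Q"
  shows "weak_equivalence C E (comp_ftor C Q P)"
proof -
  interpret P: cat_functor C D P using P by (simp add: weak_equivalence_def)
  interpret Q: cat_functor D E Q using Q by (simp add: weak_equivalence_def)
  note [simp] = P.fobj_Obj P.fmor_Hom Q.fobj_Obj Q.fmor_Hom Q.D.Comp_Hom
  have "bij_betw (fmor (comp_ftor C Q P) x y) (Hom C x y)
      (Hom E (fobj (comp_ftor C Q P) x) (fobj (comp_ftor C Q P) y))"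
    if "x \<in> Obj C" "y \<in> Obj C" for x y
  proof -
    have "bij_betw (fmor Q (fobj P x) (fobj P y) \<circ> fmor P x y) (Hom C x y)
        (Hom E (fobj Q (fobj P x)) (fobj Q (fobj P y)))"
      using P Q that by (intro bij_betw_trans) (auto simp: weak_equivalence_def)
    then show ?thesis using that by (simp add: o_def) (simp cong: bij_betw_cong)
  qed
  moreover have "\<exists>c\<in>Obj C. \<exists>h. is_iso E (fobj (comp_ftor C Q P) c) e h" if e: "e \<in> Obj E" for e
  proof -
    obtain d h where d [simp]: "d \<in> Obj D" and h: "is_iso E (fobj Q d) e h"
      using Q e unfolding weak_equivalence_def by blast
    obtain c k where c [simp]: "c \<in> Obj C" and k: "is_iso D (fobj P c) d k"
      using P d unfolding weak_equivalence_def by blast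
    let ?x = "fobj Q (fobj P c)" and ?y = "fobj Q d"
    obtain h' where h': "h \<in> Hom E ?y e" "h' \<in> Hom E e ?y" "Comp E ?y e ?y h' h = Idn E ?y"
        "Comp E e ?y e h h' = Idn E e"
      using h by (rule is_isoE)
    obtain k' where k': "k \<in> Hom D (fobj P c) d" "k' \<in> Hom D d (fobj P c)"
        "Comp D (fobj P c) d (fobj P c) k' k = Idn D (fobj P c)" "Comp D d (fobj P c) d k k' = Idn D d"
      using k by (rule is_isoE)
    define l where "l = fmor Q (fobj P c) d k"
    define l' where "l' = fmor Q d (fobj P c) k'"
    have l: "l \<in> Hom E ?x ?y" "l' \<in> Hom E ?y ?x"
      "Comp E ?x ?y ?x l' l = Idn E ?x" "Comp E ?y ?x ?y l l' = Idn E ?y"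
      using k' by (simp_all add: l_def l'_def Q.fmor_Comp[symmetric] Q.fmor_Idn)
    \<comment> \<open>The isomorphism onto \<open>e\<close> is \<open>h\<close> after
      \<open>Q k\<close>. Both round trips are rebracketed so that an inverse pair meets in the
      middle.\<close>
    have "Comp E ?x e ?x (Comp E e ?y ?x l' h') (Comp E ?x ?y e h l) =
        Comp E ?x ?y ?x l' (Comp E ?x ?y ?y (Comp E ?y e ?y h' h) l)"
      using e h'(1,2) l(1,2) by (simp add: Q.D.Comp_assoc)
    moreover have "Comp E e ?x e (Comp E ?x ?y e h l) (Comp E e ?y ?x l' h') =
        Comp E e ?y e h (Comp E e ?y ?y (Comp E ?y ?x ?y l l') h')"
      using e h'(1,2) l(1,2) by (simp add: Q.D.Comp_assoc)
    ultimately have "is_iso E ?x e (Comp E ?x ?y e h l)"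
      using e h' l unfolding is_iso_def
      by (auto simp: Q.D.Comp_Idn_left intro!: bexI[of _ "Comp E e ?y ?x l' h'"])
    then show ?thesis using c by auto
  qed
  moreover have "cat_functor C E (comp_ftor C Q P)"
    by (rule cat_functor_comp_ftor) unfold_locales
  ultimately show ?thesis by (simp add: weak_equivalence_def)
qed

text \<open>The quasi-inverse picks a preimage \<open>c d\<close> up to isomorphism for each object;
  an arrow is carried to the images of the chosen preimages and then lifted uniquely through
  \<open>P\<close>.\<close>

lemma weak_equivalence_imp_equivalence:
  assumes P: "weak_equivalence C D P"
  shows "equivalence_of_categories C D P"
proof -
  interpret P: cat_functor C D P using P by (simp add: weak_equivalence_def)
  have "\<forall>d\<in>Obj D. \<exists>c h k. c \<in> Obj C \<and> h \<in> Hom D (fobj P c) d \<and> k \<in> Hom D d (fobj P c) \<and>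
      Comp D (fobj P c) d (fobj P c) k h = Idn D (fobj P c) \<and> Comp D d (fobj P c) d h k = Idn D d"
    using P by (fastforce simp: weak_equivalence_def is_iso_def)
  then obtain c h k where c: "\<And>d. d \<in> Obj D \<Longrightarrow> c d \<in> Obj C"
    and h: "\<And>d. d \<in> Obj D \<Longrightarrow> h d \<in> Hom D (fobj P (c d)) d"
    and k: "\<And>d. d \<in> Obj D \<Longrightarrow> k d \<in> Hom D d (fobj P (c d))"
    and kh: "\<And>d. d \<in> Obj D \<Longrightarrow> Comp D (fobj P (c d)) d (fobj P (c d)) (k d) (h d) = Idn D (fobj P (c d))"
    and hk: "\<And>d. d \<in> Obj D \<Longrightarrow> Comp D d (fobj P (c d)) d (h d) (k d) = Idn D d"
    unfolding bchoice_iff by metis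
  note [simp] = P.fobj_Obj P.fmor_Hom P.D.Comp_Hom P.C.Comp_Hom P.C.Idn_Hom P.D.Idn_Hom c h k
  define lift where "lift x y = inv_into (Hom C x y) (fmor P x y)" for x y
  have bij: "bij_betw (fmor P x y) (Hom C x y) (Hom D (fobj P x) (fobj P y))"
    if "x \<in> Obj C" "y \<in> Obj C" for x y
    using P that by (simp add: weak_equivalence_def)
  have lift [simp]: "lift x y f \<in> Hom C x y" "fmor P x y (lift x y f) = f"
    if "x \<in> Obj C" "y \<in> Obj C" "f \<in> Hom D (fobj P x) (fobj P y)" for x y f
    using bij[of x y] that bij_betw_inv_into_right[OF bij]
    by (auto simp: lift_def bij_betw_def inv_into_into)
  \<comment> \<open>Equations in \<open>C\<close> are verified below after applying
    \<open>P\<close>, where the lifts disappear.\<close>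
  have faithful: "f = g"
    if "fmor P x y f = fmor P x y g" "x \<in> Obj C" "y \<in> Obj C" "f \<in> Hom C x y" "g \<in> Hom C x y" for x y f g
    using bij that by (auto simp: bij_betw_def inj_on_def)
  define conj where "conj d d' f =
      Comp D (fobj P (c d)) d' (fobj P (c d')) (k d') (Comp D (fobj P (c d)) d d' f (h d))" for d d' f
  have conj [simp]: "conj d d' f \<in> Hom D (fobj P (c d)) (fobj P (c d'))"
    if "d \<in> Obj D" "d' \<in> Obj D" "f \<in> Hom D d d'" for d d' f
    using that by (simp add: conj_def)
  \<comment> \<open>This and \<open>conj_k\<close> are the naturality squares of \<open>h\<close>
    and of its inverse \<open>k\<close>: the former gives the counit, the latter, lifted through
    \<open>P\<close>, the unit.\<close>
  have h_conj: "Comp D (fobj P (c d)) (fobj P (c d')) d' (h d') (conj d d' f) =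
      Comp D (fobj P (c d)) d d' f (h d)"
    if [simp]: "d \<in> Obj D" "d' \<in> Obj D" "f \<in> Hom D d d'" for d d' f
    unfolding conj_def by (simp add: P.D.Comp_assoc[symmetric] hk P.D.Comp_Idn_left)
  have conj_k: "Comp D d (fobj P (c d)) (fobj P (c d')) (conj d d' f) (k d) =
      Comp D d d' (fobj P (c d')) (k d') f"
    if [simp]: "d \<in> Obj D" "d' \<in> Obj D" "f \<in> Hom D d d'" for d d' f
    unfolding conj_def by (simp add: P.D.Comp_assoc hk P.D.Comp_Idn_right)
  have conj_Comp: "conj d d'' (Comp D d d' d'' g f) =
      Comp D (fobj P (c d)) (fobj P (c d')) (fobj P (c d'')) (conj d' d'' g) (conj d d' f)"
    if [simp]: "d \<in> Obj D" "d' \<in> Obj D" "d'' \<in> Obj D" "f \<in> Hom D d d'" "g \<in> Hom D d' d''"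
    for d d' d'' f g
    unfolding conj_def[of d' d''] conj_def[of d d'']
    by (simp add: P.D.Comp_assoc h_conj)
  define G where "G = \<lparr>fobj = c, fmor = (\<lambda>d d' f. lift (c d) (c d') (conj d d' f))\<rparr>"
  have G [simp]: "fobj G = c" "fmor G d d' f = lift (c d) (c d') (conj d d' f)" for d d' f
    by (simp_all add: G_def)
  have "cat_functor D C G"
  proof (unfold_locales)
    fix d assume "d \<in> Obj D"
    then show "fmor G d d (Idn D d) = Idn C (fobj G d)"
      by (intro faithful[of "c d" "c d"]) (simp_all add: P.fmor_Idn conj_def P.D.Comp_Idn_left kh)
  next
    fix d d' d'' f g
    assume "d \<in> Obj D" "d' \<in> Obj D" "d'' \<in> Obj D" "f \<in> Hom D d d'" "g \<in> Hom D d' d''"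
    then show "fmor G d d'' (Comp D d d' d'' g f) =
        Comp C (fobj G d) (fobj G d') (fobj G d'') (fmor G d' d'' g) (fmor G d d' f)"
      by (intro faithful[of "c d" "c d''"]) (simp_all add: P.fmor_Comp conj_Comp)
  qed simp_all
  moreover have "nat_iso C C (id_ftor C) (comp_ftor C G P)
      (\<lambda>x. lift x (c (fobj P x)) (k (fobj P x)))"
    unfolding nat_iso_def nat_trans_def
  proof (intro conjI ballI)
    fix x assume [simp]: "x \<in> Obj C"
    have "is_iso C x (c (fobj P x)) (lift x (c (fobj P x)) (k (fobj P x)))"
      unfolding is_iso_def
      by (intro conjI bexI[of _ "lift (c (fobj P x)) x (h (fobj P x))"] faithful[of x x]
          faithful[of "c (fobj P x)" "c (fobj P x)"])
        (simp_all add: P.fmor_Comp P.fmor_Idn kh hk)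
    then show "is_iso C (fobj (id_ftor C) x) (fobj (comp_ftor C G P) x)
        (lift x (c (fobj P x)) (k (fobj P x)))" by simp
    fix y f assume [simp]: "y \<in> Obj C" "f \<in> Hom C x y"
    show "Comp C (fobj (id_ftor C) x) (fobj (id_ftor C) y) (fobj (comp_ftor C G P) y)
        (lift y (c (fobj P y)) (k (fobj P y))) (fmor (id_ftor C) x y f) =
      Comp C (fobj (id_ftor C) x) (fobj (comp_ftor C G P) x) (fobj (comp_ftor C G P) y)
        (fmor (comp_ftor C G P) x y f) (lift x (c (fobj P x)) (k (fobj P x)))"
      by (intro faithful[of x "c (fobj P y)"]) (simp_all add: P.fmor_Comp conj_k)
  qed simp
  moreover have "is_iso D (fobj P (c d)) d (h d)" if "d \<in> Obj D" for d
    using that kh hk unfolding is_iso_def by (intro conjI bexI[of _ "k d"]) simp_all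
  then have "nat_iso D D (comp_ftor D P G) (id_ftor D) h"
    by (auto simp: nat_iso_def nat_trans_def h_conj)
  ultimately show ?thesis
    unfolding equivalence_of_categories_def using P.cat_functor_axioms by blast
qed

text \<open>On 2-cells the functor is the identity between equal hom-sets. Each functor of action
  groupoids is hit on the nose, so identities witness essential surjectivity.\<close>

lemma equivalence_mapc_E2:
  assumes A: "finite_gset A" "finite_gset B"
  shows "equivalence_of_categories (S_homc A B)
    (functor_cat (action_groupoid A) (action_groupoid B)) (mapc E2 A B)"
proof (rule weak_equivalence_imp_equivalence)
  let ?D = "functor_cat (action_groupoid A) (action_groupoid B)"
  interpret F: category ?D
    by (intro category_functor_cat category_action_groupoid assms)
  have "bij_betw (fmor (mapc E2 A B) f f') (S_cells2 A B f f') (S_cells2 A B f f')" for f f'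
    by (rule bij_betw_cong[THEN iffD1, OF _ bij_betw_id]) (auto simp: S_cells2_def PiE_restrict)
  moreover have "\<exists>f\<in>S_cells1 A B. \<exists>h. is_iso ?D (action_ftor A f) F h"
    if F: "cat_functor (action_groupoid A) (action_groupoid B) F" "ext_functor (action_groupoid A) F" for F
  proof (intro bexI exI)
    have "is_iso ?D F F (Idn ?D F)"
      using F.Idn_Hom[of F] F.Comp_Idn_left[of F F "Idn ?D F"] F unfolding is_iso_def
      by (auto simp del: functor_cat_simps(3,4))
    then show "is_iso ?D (action_ftor A (gmap_of_ftor A F)) F (Idn ?D F)"
      by (simp only: action_ftor_gmap_of_ftor[OF F(2)])
    show "gmap_of_ftor A F \<in> S_cells1 A B"
      by (rule gmap_of_ftor_S_cells1[OF A(1) F(1)])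
  qed
  ultimately show "weak_equivalence (S_homc A B) ?D (mapc E2 A B)"
    unfolding weak_equivalence_def using cat_functor_mapc_E2[OF A] A
    by (simp add: S_cells2_eq[symmetric] del: functor_cat_simps(2))
qed

section \<open>Groupoids as action groupoids\<close>

text \<open>\<open>group_action\<close> asks for a homomorphism into \<open>BijGroup\<close>, whose
  elements are extensional bijections. Bijectivity is automatic from the pointwise laws, since the
  inverse group element acts as the inverse map.\<close>

lemma finite_gsetI:
  assumes G: "group (grp A)" and fin: "finite (carrier (grp A))" "finite (pts A)"
    and ext: "\<And>g. g \<in> carrier (grp A) \<Longrightarrow> act A g \<in> extensional (pts A)"
    and mem: "\<And>g x. \<lbrakk>g \<in> carrier (grp A); x \<in> pts A\<rbrakk> \<Longrightarrow> act A g x \<in> pts A"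
    and one: "\<And>x. x \<in> pts A \<Longrightarrow> act A \<one>\<^bsub>grp A\<^esub> x = x"
    and mult: "\<And>g h x. \<lbrakk>g \<in> carrier (grp A); h \<in> carrier (grp A); x \<in> pts A\<rbrakk>
      \<Longrightarrow> act A (g \<otimes>\<^bsub>grp A\<^esub> h) x = act A g (act A h x)"
  shows "finite_gset A"
proof -
  interpret G: group "grp A" by fact
  have Bij: "act A g \<in> Bij (pts A)" if g: "g \<in> carrier (grp A)" for g
  proof -
    have "bij_betw (act A g) (pts A) (pts A)"
      by (rule bij_betw_byWitness[where f' = "act A (inv\<^bsub>grp A\<^esub> g)"])
        (use g in \<open>auto simp: mult[symmetric] one mem\<close>)
    then show ?thesis using ext[OF g] by (simp add: Bij_def)
  qed
  have "act A \<in> hom (grp A) (BijGroup (pts A))"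
  proof (rule homI)
    fix g h assume g: "g \<in> carrier (grp A)" and h: "h \<in> carrier (grp A)"
    show "act A (g \<otimes>\<^bsub>grp A\<^esub> h) = act A g \<otimes>\<^bsub>BijGroup (pts A)\<^esub> act A h"
      by (rule extensionalityI[of _ "pts A"])
        (use g h Bij in \<open>auto simp: ext BijGroup_def compose_def mult\<close>)
  qed (use Bij in \<open>simp add: BijGroup_def\<close>)
  then show ?thesis
    using G fin by (simp add: finite_gset_def group_action_def group_hom_def
        group_hom_axioms_def group_BijGroup)
qed

lemma finite_inj_into_infinite:
  assumes "finite S"
  obtains j :: "'a \<Rightarrow> 'b::infinite" where "inj_on j S"
proof -
  obtain T :: "'b set" where T: "card T = card S" "finite T"
    using infinite_arbitrarily_large[OF infinite_UNIV] by metis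
  then obtain j where "bij_betw j S T"
    using finite_same_card_bij[OF assms] by metis
  then show thesis using that by (auto simp: bij_betw_def)
qed

text \<open>Relabelling along injections \<open>i\<close> of the points and \<open>j\<close> of the
  group elements; \<open>u\<close> and \<open>v\<close> undo the labels. The resulting functor is
  bijective on objects and on each hom-set.\<close>

lemma finite_gset_transport:
  fixes A :: "('y, 'h) gset"
  assumes A: "finite_gset A"
  obtains B :: "('x::infinite, 'g::infinite) gset" and P where
    "finite_gset B" "weak_equivalence (action_groupoid A) (action_groupoid B) P"
proof -
  interpret A: finite_action A by unfold_locales fact
  have fin: "finite (carrier (grp A))" "finite (pts A)"
    using A by (simp_all add: finite_gset_def)
  obtain i :: "'y \<Rightarrow> 'x" where i: "inj_on i (pts A)"
    using finite_inj_into_infinite[OF fin(2)] .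
  obtain j :: "'h \<Rightarrow> 'g" where j: "inj_on j (carrier (grp A))"
    using finite_inj_into_infinite[OF fin(1)] .
  define u where "u = inv_into (pts A) i"
  define v where "v = inv_into (carrier (grp A)) j"
  have [simp]: "\<And>x. x \<in> pts A \<Longrightarrow> u (i x) = x" "\<And>g. g \<in> carrier (grp A) \<Longrightarrow> v (j g) = g"
    using i j by (simp_all add: u_def v_def)
  define B :: "('x, 'g) gset" where "B = \<lparr>
    grp = \<lparr>carrier = j ` carrier (grp A), monoid.mult = (\<lambda>g h. j (v g \<otimes>\<^bsub>grp A\<^esub> v h)), one = j \<one>\<^bsub>grp A\<^esub>\<rparr>,
    pts = i ` pts A, act = (\<lambda>g. \<lambda>x\<in>i ` pts A. i (act A (v g) (u x)))\<rparr>"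
  have B [simp]: "carrier (grp B) = j ` carrier (grp A)" "g \<otimes>\<^bsub>grp B\<^esub> h = j (v g \<otimes>\<^bsub>grp A\<^esub> v h)"
    "\<one>\<^bsub>grp B\<^esub> = j \<one>\<^bsub>grp A\<^esub>" "pts B = i ` pts A"
    "act B g = (\<lambda>x\<in>i ` pts A. i (act A (v g) (u x)))" for g h
    by (simp_all add: B_def)
  have "group (grp B)"
    by (rule groupI) (auto simp: A.m_assoc, metis A.l_inv_ex)
  then have gB: "finite_gset B"
    by (rule finite_gsetI) (auto simp: fin A.act_mult dest!: inj_onD[OF i])
  interpret cA: category "action_groupoid A" by (rule category_action_groupoid[OF A])
  interpret cB: category "action_groupoid B" by (rule category_action_groupoid[OF gB])
  define P :: "('y, 'h, 'x, 'g) ftor" where "P = \<lparr>fobj = i, fmor = (\<lambda>x y. j)\<rparr>"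
  have P [simp]: "fobj P = i" "fmor P x y = j" for x y by (simp_all add: P_def)
  have "cat_functor (action_groupoid A) (action_groupoid B) P"
    by unfold_locales auto
  moreover have "bij_betw j (Hom (action_groupoid A) x y) (Hom (action_groupoid B) (i x) (i y))"
    if "x \<in> pts A" "y \<in> pts A" for x y
    using that i j by (auto simp: bij_betw_def inj_on_def)
  moreover have "is_iso (action_groupoid B) x x (j \<one>\<^bsub>grp A\<^esub>)" if "x \<in> pts B" for x
    using that by (intro is_iso_action_groupoid gB) auto
  ultimately have "weak_equivalence (action_groupoid A) (action_groupoid B) P"
    unfolding weak_equivalence_def by fastforce
  then show thesis using that gB by blast
qed

section \<open>Realising a groupoid by an action of a product of automorphism groups\<close>

definition Aut :: "('o, 'm) cat \<Rightarrow> 'o \<Rightarrow> 'm monoid" where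
  "Aut C x = \<lparr>carrier = Hom C x x, monoid.mult = Comp C x x x, one = Idn C x\<rparr>"

lemma Aut_simps [simp]:
  "carrier (Aut C x) = Hom C x x" "f \<otimes>\<^bsub>Aut C x\<^esub> g = Comp C x x x f g" "\<one>\<^bsub>Aut C x\<^esub> = Idn C x"
  by (simp_all add: Aut_def)

locale groupoid = category +
  assumes iso: "\<lbrakk>x \<in> Obj C; y \<in> Obj C; f \<in> Hom C x y\<rbrakk> \<Longrightarrow> is_iso C x y f"
begin

lemma group_Aut:
  assumes "x \<in> Obj C" shows "group (Aut C x)"
  by (rule groupI) (use assms iso[of x x] in
      \<open>auto simp: Idn_Hom Comp_Hom Comp_Idn_left Comp_assoc is_iso_def\<close>)

text \<open>The chosen \<open>r x\<close> depends only on the set \<open>S x\<close> of objects with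
  an arrow to \<open>x\<close>. An arrow between two objects makes these sets equal, hence also the
  choices.\<close>

lemma representatives:
  "\<exists>r t u. (\<forall>x\<in>Obj C. \<forall>y\<in>Obj C. \<forall>f\<in>Hom C x y. r x = r y) \<and>
    (\<forall>x\<in>Obj C. r x \<in> Obj C \<and> t x \<in> Hom C (r x) x \<and> u x \<in> Hom C x (r x) \<and>
      Comp C (r x) x (r x) (u x) (t x) = Idn C (r x) \<and> Comp C x (r x) x (t x) (u x) = Idn C x)"
proof -
  define S where "S x = {y \<in> Obj C. Hom C y x \<noteq> {}}" for x
  define r where "r x = (SOME y. y \<in> S x)" for x
  have "x \<in> S x" if "x \<in> Obj C" for x
    using that Idn_Hom by (auto simp: S_def)
  then have r: "r x \<in> S x" if "x \<in> Obj C" for x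
    using that unfolding r_def by (metis someI)
  have sub: "S x \<subseteq> S y" if "x \<in> Obj C" "y \<in> Obj C" "f \<in> Hom C x y" for x y f
    using that Comp_Hom by (fastforce simp: S_def)
  have "r x = r y" if f: "x \<in> Obj C" "y \<in> Obj C" "f \<in> Hom C x y" for x y f
  proof -
    obtain g where "g \<in> Hom C y x" using iso[OF f] by (auto simp: is_iso_def)
    then have "S x = S y" using sub f by blast
    then show ?thesis by (simp add: r_def)
  qed
  moreover have "\<forall>x\<in>Obj C. \<exists>t u. t \<in> Hom C (r x) x \<and> u \<in> Hom C x (r x) \<and>
      Comp C (r x) x (r x) u t = Idn C (r x) \<and> Comp C x (r x) x t u = Idn C x"
  proof
    fix x assume x: "x \<in> Obj C"
    then obtain t where "t \<in> Hom C (r x) x" using r by (auto simp: S_def)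
    then show "\<exists>t u. t \<in> Hom C (r x) x \<and> u \<in> Hom C x (r x) \<and>
      Comp C (r x) x (r x) u t = Idn C (r x) \<and> Comp C x (r x) x t u = Idn C x"
      using iso[of "r x" x t] r[OF x] x by (auto simp: S_def is_iso_def)
  qed
  then obtain t u where "\<forall>x\<in>Obj C. t x \<in> Hom C (r x) x \<and> u x \<in> Hom C x (r x) \<and>
      Comp C (r x) x (r x) (u x) (t x) = Idn C (r x) \<and> Comp C x (r x) x (t x) (u x) = Idn C x"
    unfolding bchoice_iff by blast
  ultimately show ?thesis using r
    by (intro exI[of _ r] exI[of _ t] exI[of _ u]) (auto simp: S_def)
qed

text \<open>
  The coset space \<open>G / Aut r\<close> is encoded as \<open>\<Prod>s\<noteq>r. Aut s\<close>, on which \<open>G\<close> acts by left multiplication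
  through the projection that forgets the \<open>r\<close>-component.
\<close>

lemma weakly_equivalent_action_groupoid:
  assumes fin: "finite (Obj C)" "\<And>x. x \<in> Obj C \<Longrightarrow> finite (Hom C x x)"
  obtains A :: "('a \<times> ('a \<Rightarrow> 'b), 'a \<Rightarrow> 'b) gset" and P where
    "finite_gset A" "weak_equivalence C (action_groupoid A) P"
proof -
  obtain r t u where r_eq: "\<forall>x\<in>Obj C. \<forall>y\<in>Obj C. \<forall>f\<in>Hom C x y. r x = r y"
    and rtu: "\<forall>x\<in>Obj C. r x \<in> Obj C \<and> t x \<in> Hom C (r x) x \<and> u x \<in> Hom C x (r x) \<and>
      Comp C (r x) x (r x) (u x) (t x) = Idn C (r x) \<and> Comp C x (r x) x (t x) (u x) = Idn C x"
    using representatives by blast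
  have r_eq: "r x = r y" if "x \<in> Obj C" "y \<in> Obj C" "f \<in> Hom C x y" for x y f
    using r_eq that by blast
  have r: "r x \<in> Obj C" and t: "t x \<in> Hom C (r x) x" and u: "u x \<in> Hom C x (r x)"
    and ut: "Comp C (r x) x (r x) (u x) (t x) = Idn C (r x)"
    and tu: "Comp C x (r x) x (t x) (u x) = Idn C x" if "x \<in> Obj C" for x
    using rtu that by auto
  define R where "R = r ` Obj C"
  have R: "\<And>s. s \<in> R \<Longrightarrow> s \<in> Obj C" using r by (auto simp: R_def)
  have rR: "\<And>x. x \<in> Obj C \<Longrightarrow> r x \<in> R" by (auto simp: R_def)
  \<comment> \<open>A coset of the factor \<open>Aut r\<close> is determined by its coordinates away
    from \<open>r\<close>, which are recorded as \<open>p\<close>; the label \<open>r\<close> keeps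
    the orbits apart.\<close>
  define X where "X = Sigma R (\<lambda>r. \<Pi>\<^sub>E s\<in>R - {r}. Hom C s s)"
  define A where "A = \<lparr>grp = product_group R (Aut C), pts = X,
    act = (\<lambda>g. \<lambda>(r, p)\<in>X. (r, \<lambda>s\<in>R - {r}. Comp C s s s (g s) (p s)))\<rparr>"
  have A [simp]: "grp A = product_group R (Aut C)" "pts A = X" by (simp_all add: A_def)
  have act [simp]: "act A g (s, p) = (s, \<lambda>s'\<in>R - {s}. Comp C s' s' s' (g s') (p s'))"
    if "s \<in> R" "p \<in> (\<Pi>\<^sub>E s\<in>R - {s}. Hom C s s)" for g s p
    using that by (simp add: A_def X_def)
  have finR: "finite R" using fin by (simp add: R_def)
  have gA: "finite_gset A"
  proof (rule finite_gsetI)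
    show "group (grp A)" using R by (simp add: group_Aut)
    show "finite (carrier (grp A))" "finite (pts A)"
      using R fin finR by (auto simp: X_def intro!: finite_PiE finite_SigmaI)
    show "act A g \<in> extensional (pts A)" for g by (simp add: A_def)
    fix x assume "x \<in> pts A"
    then obtain s p where x [simp]: "x = (s, p)" and s [simp]: "s \<in> R"
      and p [simp]: "p \<in> (\<Pi>\<^sub>E s\<in>R - {s}. Hom C s s)"
      by (auto simp: X_def)
    show "act A \<one>\<^bsub>grp A\<^esub> x = x"
      using p R by (auto simp: PiE_iff Comp_Idn_left intro!: extensionalityI[of _ "R - {s}"]
          split: if_splits)
    fix g assume g: "g \<in> carrier (grp A)"
    show "act A g x \<in> pts A" using g p R by (auto simp: X_def PiE_iff intro!: Comp_Hom)
    fix h assume h: "h \<in> carrier (grp A)"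
    \<comment> \<open>The rule \<open>act\<close> evaluates the outer action of \<open>g\<close>
      only once the moved coordinates are known to lie in the product.\<close>
    have "(\<lambda>s'\<in>R - {s}. Comp C s' s' s' (h s') (p s')) \<in> (\<Pi>\<^sub>E s\<in>R - {s}. Hom C s s)"
      using h p R by (auto simp: PiE_iff intro!: Comp_Hom)
    then show "act A (g \<otimes>\<^bsub>grp A\<^esub> h) x = act A g (act A h x)"
      using g h p R by (auto simp: PiE_iff Comp_assoc intro!: restrict_ext split: if_splits)
  qed
  define conj where "conj x y f = Comp C (r x) y (r y) (u y) (Comp C (r x) x y f (t x))" for x y f
  note [simp] = r t u Comp_Hom Idn_Hom
  have conj_Hom [simp]: "conj x y f \<in> Hom C (r x) (r y)"
    if "x \<in> Obj C" "y \<in> Obj C" "f \<in> Hom C x y" for x y f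
    using that by (simp add: conj_def)
  have conj_Idn: "conj x x (Idn C x) = Idn C (r x)" if "x \<in> Obj C" for x
    using that by (simp add: conj_def Comp_Idn_left[of "r x"] ut)
  \<comment> \<open>The inner pair \<open>t y\<close>, \<open>u y\<close> cancels.\<close>
  have conj_Comp: "conj x z (Comp C x y z g f) = Comp C (r x) (r y) (r z) (conj y z g) (conj x y f)"
    if [simp]: "x \<in> Obj C" "y \<in> Obj C" "z \<in> Obj C" "f \<in> Hom C x y" "g \<in> Hom C y z" for x y z f g
  proof -
    have "Comp C (r x) (r y) (r z) (conj y z g) (conj x y f) =
        Comp C (r x) z (r z) (u z) (Comp C (r x) y z g
          (Comp C (r x) (r y) y (t y) (Comp C (r x) y (r y) (u y) (Comp C (r x) x y f (t x)))))"
      by (simp add: conj_def Comp_assoc)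
    also have "Comp C (r x) (r y) y (t y) (Comp C (r x) y (r y) (u y) (Comp C (r x) x y f (t x))) =
        Comp C (r x) x y f (t x)"
      by (simp add: Comp_assoc[symmetric] tu Comp_Idn_left)
    finally show ?thesis by (simp add: conj_def Comp_assoc)
  qed
  have bij_conj: "bij_betw (conj x y) (Hom C x y) (Hom C (r x) (r y))"
    if [simp]: "x \<in> Obj C" "y \<in> Obj C" for x y
  proof (rule bij_betw_byWitness[where
        f' = "\<lambda>g. Comp C x (r y) y (t y) (Comp C x (r x) (r y) g (u x))"])
    show "\<forall>f\<in>Hom C x y. Comp C x (r y) y (t y) (Comp C x (r x) (r y) (conj x y f) (u x)) = f"
    proof
      fix f assume [simp]: "f \<in> Hom C x y"
      have "Comp C x (r y) y (t y) (Comp C x (r x) (r y) (conj x y f) (u x)) =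
          Comp C x y y (Comp C y (r y) y (t y) (u y)) (Comp C x x y f (Comp C x (r x) x (t x) (u x)))"
        by (simp add: conj_def Comp_assoc)
      then show "Comp C x (r y) y (t y) (Comp C x (r x) (r y) (conj x y f) (u x)) = f"
        by (simp add: tu Comp_Idn_left Comp_Idn_right)
    qed
    show "\<forall>g\<in>Hom C (r x) (r y). conj x y (Comp C x (r y) y (t y) (Comp C x (r x) (r y) g (u x))) = g"
    proof
      fix g assume [simp]: "g \<in> Hom C (r x) (r y)"
      have "conj x y (Comp C x (r y) y (t y) (Comp C x (r x) (r y) g (u x))) =
          Comp C (r x) (r y) (r y) (Comp C (r y) y (r y) (u y) (t y))
            (Comp C (r x) (r x) (r y) g (Comp C (r x) x (r x) (u x) (t x)))"
        by (simp add: conj_def Comp_assoc)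
      then show "conj x y (Comp C x (r y) y (t y) (Comp C x (r x) (r y) g (u x))) = g"
        by (simp add: ut Comp_Idn_left Comp_Idn_right)
    qed
  qed auto
  \<comment> \<open>\<open>x\<close> goes to the base point of the orbit labelled
    \<open>r x\<close>, the coset of the unit. An arrow becomes the group element with its conjugate
    at \<open>r x\<close> and identities elsewhere.\<close>
  define P where "P = \<lparr>fobj = (\<lambda>x. (r x, \<lambda>s\<in>R - {r x}. Idn C s)),
    fmor = (\<lambda>x y f. \<lambda>s\<in>R. if s = r x then conj x y f else Idn C s)\<rparr>"
  have P [simp]: "fobj P x = (r x, \<lambda>s\<in>R - {r x}. Idn C s)"
    "fmor P x y f = (\<lambda>s\<in>R. if s = r x then conj x y f else Idn C s)" for x y f
    by (simp_all add: P_def)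
  have one_PiE [simp]: "(\<lambda>s\<in>R - {s'}. Idn C s) \<in> (\<Pi>\<^sub>E s\<in>R - {s'}. Hom C s s)" for s'
    using R by auto
  interpret cA: category "action_groupoid A" by (rule category_action_groupoid[OF gA])
  have fobj_X [simp]: "fobj P x \<in> X" if "x \<in> Obj C" for x
    using that R by (auto simp: X_def R_def)
  \<comment> \<open>Between base points there are no arrows unless the representatives agree; then
    the arrows form the stabiliser, a copy of \<open>Aut (r x)\<close> inside the product.\<close>
  have Hom_X: "g \<in> Hom (action_groupoid A) (fobj P x) (fobj P y) \<longleftrightarrow>
      r x = r y \<and> g \<in> extensional R \<and> g (r x) \<in> Hom C (r x) (r x) \<and> (\<forall>s\<in>R - {r x}. g s = Idn C s)"
    if "x \<in> Obj C" "y \<in> Obj C" for x y g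
  proof -
    have restrict_eq: "restrict g S = restrict h S \<longleftrightarrow> (\<forall>s\<in>S. g s = h s)" for S h
      by (metis restrict_apply' restrict_ext)
    \<comment> \<open>Acting on a base point just forgets the coordinate at \<open>r x\<close>, so
      fixing it means being an identity at all other coordinates.\<close>
    have act_one: "act A g (fobj P x) = (r x, restrict g (R - {r x}))"
      if "g \<in> carrier (grp A)"
    proof -
      have "Comp C s s s (g s) (Idn C s) = g s" if "s \<in> R" for s
        using that R \<open>g \<in> carrier (grp A)\<close> by (auto simp: PiE_iff intro!: Comp_Idn_right)
      then show ?thesis by (simp add: act[OF rR[OF \<open>x \<in> Obj C\<close>] one_PiE] cong: restrict_cong)
    qed
    have "g \<in> Hom (action_groupoid A) (fobj P x) (fobj P y) \<longleftrightarrow>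
        g \<in> carrier (grp A) \<and> (r x, restrict g (R - {r x})) = fobj P y"
      unfolding action_groupoid_simps using act_one by auto
    also have "\<dots> \<longleftrightarrow> g \<in> carrier (grp A) \<and> r x = r y \<and> (\<forall>s\<in>R - {r x}. g s = Idn C s)"
      by (cases "r x = r y") (simp_all add: restrict_eq del: A)
    also have "\<dots> \<longleftrightarrow> r x = r y \<and> g \<in> extensional R \<and> g (r x) \<in> Hom C (r x) (r x) \<and>
        (\<forall>s\<in>R - {r x}. g s = Idn C s)"
    proof -
      have "g \<in> carrier (grp A) \<longleftrightarrow> g \<in> extensional R \<and> g (r x) \<in> Hom C (r x) (r x)"
        if g: "\<forall>s\<in>R - {r x}. g s = Idn C s"
      proof -
        have "g s \<in> Hom C s s" if "s \<in> R" "g (r x) \<in> Hom C (r x) (r x)" for s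
          using that R g by (cases "s = r x") auto
        then show ?thesis
          using rR[OF \<open>x \<in> Obj C\<close>] by (auto simp: PiE_iff)
      qed
      then show ?thesis by blast
    qed
    finally show ?thesis .
  qed
  have "cat_functor C (action_groupoid A) P"
  proof unfold_locales
    fix x assume x: "x \<in> Obj C"
    then show "fobj P x \<in> Obj (action_groupoid A)"
      unfolding action_groupoid_simps A by (rule fobj_X)
    show "fmor P x x (Idn C x) = Idn (action_groupoid A) (fobj P x)"
      using x by (auto simp: conj_Idn intro!: restrict_ext)
    fix y f assume y: "y \<in> Obj C" "f \<in> Hom C x y"
    show "fmor P x y f \<in> Hom (action_groupoid A) (fobj P x) (fobj P y)"
      unfolding Hom_X[OF x y(1)] using x y conj_Hom[OF x y] r_eq[OF x y] rR by simp
    fix z g assume z: "z \<in> Obj C" "g \<in> Hom C y z"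
    show "fmor P x z (Comp C x y z g f) =
        Comp (action_groupoid A) (fobj P x) (fobj P y) (fobj P z) (fmor P y z g) (fmor P x y f)"
      using r_eq[OF x y] r_eq[OF y(1) z] conj_Comp[OF x y(1) z(1) y(2) z(2)] R
      by (auto simp: Comp_Idn_left intro!: restrict_ext)
  qed
  moreover have "bij_betw (fmor P x y) (Hom C x y) (Hom (action_groupoid A) (fobj P x) (fobj P y))"
    if xy: "x \<in> Obj C" "y \<in> Obj C" for x y
    unfolding bij_betw_def
  proof
    show "inj_on (fmor P x y) (Hom C x y)"
    proof (rule inj_onI)
      fix f g assume fg: "f \<in> Hom C x y" "g \<in> Hom C x y" "fmor P x y f = fmor P x y g"
      have "conj x y f = conj x y g"
        using arg_cong[OF fg(3), of "\<lambda>h. h (r x)"] rR[OF xy(1)] by simp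
      then show "f = g" using bij_conj[OF xy] fg by (auto simp: bij_betw_def inj_on_def)
    qed
    show "fmor P x y ` Hom C x y = Hom (action_groupoid A) (fobj P x) (fobj P y)"
    proof
      show "fmor P x y ` Hom C x y \<subseteq> Hom (action_groupoid A) (fobj P x) (fobj P y)"
        using calculation xy by (blast intro: cat_functor.fmor_Hom)
      show "Hom (action_groupoid A) (fobj P x) (fobj P y) \<subseteq> fmor P x y ` Hom C x y"
      proof
        fix g assume "g \<in> Hom (action_groupoid A) (fobj P x) (fobj P y)"
        then have g: "r x = r y" "g \<in> extensional R" "g (r x) \<in> Hom C (r x) (r x)"
          "\<forall>s\<in>R - {r x}. g s = Idn C s"
          unfolding Hom_X[OF xy] by auto
        then obtain f where f: "f \<in> Hom C x y" "conj x y f = g (r x)"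
          using bij_conj[OF xy] by (metis bij_betw_iff_bijections)
        have "fmor P x y f = g"
          by (rule extensionalityI[of _ R]) (use f g in auto)
        then show "g \<in> fmor P x y ` Hom C x y" using f by blast
      qed
    qed
  qed
  moreover have "\<exists>x\<in>Obj C. \<exists>g. is_iso (action_groupoid A) (fobj P x) d g"
    if d: "d \<in> Obj (action_groupoid A)" for d
  proof -
    obtain s p where d: "d = (s, p)" and s: "s \<in> R" and p: "p \<in> (\<Pi>\<^sub>E s\<in>R - {s}. Hom C s s)"
      using d by (auto simp: X_def)
    obtain x where x: "x \<in> Obj C" "s = r x" using s by (auto simp: R_def)
    \<comment> \<open>Transitivity on the orbit: the coordinates \<open>p\<close> themselves form a
      group element carrying the base point to \<open>(s, p)\<close>. The coordinate at
      \<open>s\<close> is free and is set to the identity.\<close>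
    define g where "g = (\<lambda>s'\<in>R. if s' = s then Idn C s else p s')"
    have "g \<in> carrier (grp A)" using p R by (auto simp: g_def PiE_iff)
    moreover have "act A g (fobj P x) = d"
      using p s R x(2) unfolding d
      by (auto simp: g_def PiE_iff Comp_Idn_right intro!: extensionalityI[of _ "R - {r x}"] split: if_splits)
    ultimately have "is_iso (action_groupoid A) (fobj P x) d g"
      using x(1) by (intro is_iso_action_groupoid gA) (simp_all del: P)
    then show ?thesis using x(1) by blast
  qed
  ultimately have "weak_equivalence C (action_groupoid A) P"
    unfolding weak_equivalence_def by blast
  then show thesis using that gA by blast
qed

end

text \<open>Both steps produce functors out of \<open>\<G>\<close>; they are composed as weak
  equivalences, and the resulting equivalence is turned around. The types of \<open>\<G>\<close> and
  of the 0-cell are independent.\<close>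

lemma equivalent_to_action_groupoid:
  fixes \<G> :: "('o, 'm) cat"
  assumes "finite_groupoid \<G>"
  obtains A :: "('x::infinite, 'g::infinite) gset" and F where
    "finite_gset A" "equivalence_of_categories (action_groupoid A) \<G> F"
proof -
  interpret groupoid \<G>
    using assms by (simp add: groupoid_def groupoid_axioms_def finite_groupoid_def)
  obtain A0 :: "('o \<times> ('o \<Rightarrow> 'm), 'o \<Rightarrow> 'm) gset" and P where
    "finite_gset A0" and P: "weak_equivalence \<G> (action_groupoid A0) P"
    using weakly_equivalent_action_groupoid assms by (auto simp: finite_groupoid_def)
  then obtain A :: "('x, 'g) gset" and Q where
    A: "finite_gset A" and Q: "weak_equivalence (action_groupoid A0) (action_groupoid A) Q"
    using finite_gset_transport by blast
  have "equivalence_of_categories \<G> (action_groupoid A) (comp_ftor \<G> Q P)"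
    by (rule weak_equivalence_imp_equivalence[OF weak_equivalence_comp_ftor[OF P Q]])
  then show thesis using that A equivalence_of_categories_sym by blast
qed

theorem proposition1p15:
  shows "(\<forall>\<G> :: ('o, 'm) cat. finite_groupoid \<G> \<longrightarrow>
            (\<exists>A \<in> Cells0 (S2 :: (('x::infinite, 'g::infinite) gset, ('x, 'g) gmap, 'x \<Rightarrow> 'g) two_cat).
              \<exists>F. equivalence_of_categories (map0 E2 A) \<G> F)) \<and>
         biequivalence
            (S2 :: (('x, 'g) gset, ('x, 'g) gmap, 'x \<Rightarrow> 'g) two_cat)
            (finGpd :: (('x, 'g) cat, ('x, 'g, 'x, 'g) ftor, 'x \<Rightarrow> 'g) two_cat)
            E2"
proof
  show "\<forall>\<G> :: ('o, 'm) cat. finite_groupoid \<G> \<longrightarrow>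
    (\<exists>A \<in> Cells0 (S2 :: (('x, 'g) gset, ('x, 'g) gmap, 'x \<Rightarrow> 'g) two_cat).
      \<exists>F. equivalence_of_categories (map0 E2 A) \<G> F)"
    by (metis equivalent_to_action_groupoid S2_simps(1) E2_simps(1) mem_Collect_eq)
  \<comment> \<open>Surjectivity up to equivalence is the first claim for groupoids over the
    universe \<open>'x\<close>, \<open>'g\<close> itself.\<close>
  have "\<exists>A\<in>Cells0 S2. equivalent_cells0 finGpd (map0 E2 A) D"
    if "D \<in> Cells0 finGpd" for D :: "('x, 'g) cat"
  proof -
    obtain A :: "('x, 'g) gset" and F where
      "finite_gset A" "equivalence_of_categories (action_groupoid A) D F"
      using equivalent_to_action_groupoid[of D] \<open>D \<in> Cells0 finGpd\<close> by auto
    then show ?thesis using equivalent_cells0_finGpdI by auto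
  qed
  then show "biequivalence
      (S2 :: (('x, 'g) gset, ('x, 'g) gmap, 'x \<Rightarrow> 'g) two_cat)
      (finGpd :: (('x, 'g) cat, ('x, 'g, 'x, 'g) ftor, 'x \<Rightarrow> 'g) two_cat) E2"
    unfolding biequivalence_def by (simp add: strict_two_functor_E2 equivalence_mapc_E2)
qed

end
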